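(* Let $d\geq1$ and $k\geq2$ be integers and let $w>\bigl(2d+1+\sqrt{4d^2+1}\bigr)/2$ with $w\in S_k$. Then there exists a $k$-automatic sequence $(a_n)_{n\geq0}$ over $\mathbb{F}_q$ such that, with $\xi=\sum_{n=0}^{\infty}a_nT^{-n}$, \[ w_1(\xi)=w_1^{*}(\xi)=\ldots=w_d(\xi)=w_d^{*}(\xi)=w-1 . \]
   Context: Let $p$ be a prime and $q$ a power of $p$. $\mathbb{F}_q((T^{-1}))$ is the field of Laurent series $\xi=\sum_{n\geq N}a_nT^{-n}$ ($a_n\in\mathbb{F}_q$), with absolute value $|0|=0$ and $|\xi|=q^{-N}$ if $a_N\neq 0$; this absolute value is extended uniquely to an algebraic closure $\overline{\mathbb{F}_q(T)}$. The height $H(P)$ of $P\in(\mathbb{F}_q[T])[X]$ is the maximum of the absolute values of its coefficients. Every $\alpha\in\overline{\mathbb{F}_q(T)}$ is a root of a unique non-constant, irreducible, primitive $P\in(\mathbb{F}_q[T])[X]$ whose leading coefficient is monic in $T$; $H(\alpha)$ and $\deg\alpha$ denote the height and degree of this polynomial. For $\xi\in\mathbb{F}_q((T^{-1}))$ and $n\geq1$, $w_n(\xi)$ is the supremum of real $w$ such that $0<|P(\xi)|\leq H(P)^{-w}$ for infinitely many $P\in(\mathbb{F}_q[T])[X]$ of degree at most $n$, and $w_n^{*}(\xi)$ is the supremum of real $w^*$ such that $0<|\xi-\alpha|\leq H(\alpha)^{-w^*-1}$ for infinitely many $\alpha\in\overline{\mathbb{F}_q(T)}$ of degree at most $n$.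 For $k\geq2$, $S_k:=\{k^a/\ell : a,\ell\in\mathbb{Z}_{\geq1}\}$. For an integer $k\geq2$ let $\Sigma_k=\{0,1,\ldots,k-1\}$. A $k$-automaton is a sextuple $(Q,\Sigma_k,\delta,q_0,\Delta,\tau)$ with $Q$ a finite set of states, $\delta:Q\times\Sigma_k\to Q$ a transition function (extended to finite words by $\delta(q,w_0\cdots w_n)=\delta(\delta(q,w_0\cdots w_{n-1}),w_n)$), $q_0\in Q$, $\Delta$ a finite output alphabet and $\tau:Q\to\Delta$. For $n\geq0$ with base-$k$ expansion $n=\sum_{i=0}^r w_ik^i$, put $W_n=w_rw_{r-1}\cdots w_0$. A sequence $(a_n)_{n\geq0}$ is $k$-automatic if there is a $k$-automaton with $a_n=\tau(\delta(q_0,W_n))$ for all $n\geq0$. *)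

theory Defs
  imports
    "HOL-Algebra.Algebraic_Closure_Type"
    "HOL-Computational_Algebra.Formal_Laurent_Series"
    "HOL-Library.Cardinality"
    "HOL-Library.Extended_Real"
begin

text \<open>
  The field \<open>\<bbbF>\<^sub>q\<close> is an arbitrary type of class finite and field, with \<open>q = CARD('a)\<close>.
  The type \<open>'a fls\<close> plays the role of \<open>\<bbbF>\<^sub>q((T\<^sup>-\<^sup>1))\<close>: its indeterminate \<open>fls_X\<close> is \<open>T\<^sup>-\<^sup>1\<close>,
  so \<open>T\<close> is \<open>fls_X_inv\<close>. Elements of \<open>\<bbbF>\<^sub>q[T]\<close> and \<open>(\<bbbF>\<^sub>q[T])[X]\<close> have types \<open>'a poly\<close>
  and \<open>'a poly poly\<close>.
\<close>

definition abs_fls :: "'a::{finite,field} fls \<Rightarrow> real" where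
  "abs_fls \<xi> = (if \<xi> = 0 then 0 else real CARD('a) powi (- fls_subdegree \<xi>))"

definition fls_of_T_poly :: "'a::field poly \<Rightarrow> 'a fls" where
  "fls_of_T_poly c = poly (map_poly fls_const c) fls_X_inv"

definition eval_fls :: "'a::field poly poly \<Rightarrow> 'a fls \<Rightarrow> 'a fls" where
  "eval_fls P \<xi> = poly (map_poly fls_of_T_poly P) \<xi>"

definition height :: "'a::{finite,field} poly poly \<Rightarrow> real" where
  "height P = (MAX i\<in>{..Polynomial.degree P}. abs_fls (fls_of_T_poly (Polynomial.coeff P i)))"

text \<open>
  To compare \<open>\<xi> \<in> \<bbbF>\<^sub>q((T\<^sup>-\<^sup>1))\<close> with algebraic elements, the algebraic closure of \<open>\<bbbF>\<^sub>q(T)\<close>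
  is taken to be the set of elements of an algebraic closure of \<open>\<bbbF>\<^sub>q((T\<^sup>-\<^sup>1))\<close>
  that are algebraic over \<open>\<bbbF>\<^sub>q(T)\<close>. Clearing denominators, the polynomial relation can be
  taken over \<open>\<bbbF>\<^sub>q[T]\<close>.
\<close>

definition eval_ac :: "'a::field poly poly \<Rightarrow> 'a fls alg_closure \<Rightarrow> 'a fls alg_closure" where
  "eval_ac P \<alpha> = poly (map_poly (\<lambda>c. to_ac (fls_of_T_poly c)) P) \<alpha>"

definition algebraic_over_FqT :: "'a::field fls alg_closure set" where
  "algebraic_over_FqT = {\<alpha>. \<exists>P. P \<noteq> 0 \<and> eval_ac P \<alpha> = 0}"

definition is_absolute_value :: "('b::field \<Rightarrow> real) \<Rightarrow> bool" where
  "is_absolute_value v \<longleftrightarrow>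
     (\<forall>x. 0 \<le> v x) \<and> (\<forall>x. v x = 0 \<longleftrightarrow> x = 0) \<and>
     (\<forall>x y. v (x * y) = v x * v y) \<and> (\<forall>x y. v (x + y) \<le> v x + v y)"

text \<open>
  Since \<open>\<bbbF>\<^sub>q((T\<^sup>-\<^sup>1))\<close> is complete, exactly one absolute value on its algebraic closure extends
  \<^const>\<open>abs_fls\<close>; the choice operator below therefore picks that one.
\<close>

definition abs_ac :: "'a::{finite,field} fls alg_closure \<Rightarrow> real" where
  "abs_ac = (SOME v. is_absolute_value v \<and> (\<forall>\<xi>. v (to_ac \<xi>) = abs_fls \<xi>))"

definition primitive_poly :: "'b::comm_ring_1 poly \<Rightarrow> bool" where
  "primitive_poly P \<longleftrightarrow> (\<forall>c. (\<forall>i. c dvd Polynomial.coeff P i) \<longrightarrow> c dvd 1)"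

definition min_poly :: "'a::field fls alg_closure \<Rightarrow> 'a poly poly" where
  "min_poly \<alpha> = (THE P. 0 < Polynomial.degree P \<and> Factorial_Ring.irreducible P \<and>
     primitive_poly P \<and> lead_coeff (lead_coeff P) = 1 \<and> eval_ac P \<alpha> = 0)"

definition alg_height :: "'a::{finite,field} fls alg_closure \<Rightarrow> real" where
  "alg_height \<alpha> = height (min_poly \<alpha>)"

definition alg_degree :: "'a::field fls alg_closure \<Rightarrow> nat" where
  "alg_degree \<alpha> = Polynomial.degree (min_poly \<alpha>)"

definition w_exp :: "nat \<Rightarrow> 'a::{finite,field} fls \<Rightarrow> ereal" where
  "w_exp n \<xi> = Sup {ereal w | w. infinite {P. Polynomial.degree P \<le> n \<and>
     0 < abs_fls (eval_fls P \<xi>) \<and> abs_fls (eval_fls P \<xi>) \<le> height P powr (- w)}}"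

definition w_star_exp :: "nat \<Rightarrow> 'a::{finite,field} fls \<Rightarrow> ereal" where
  "w_star_exp n \<xi> = Sup {ereal w | w. infinite {\<alpha> \<in> algebraic_over_FqT. alg_degree \<alpha> \<le> n \<and>
     0 < abs_ac (to_ac \<xi> - \<alpha>) \<and> abs_ac (to_ac \<xi> - \<alpha>) \<le> alg_height \<alpha> powr (- w - 1)}}"

definition S_set :: "nat \<Rightarrow> real set" where
  "S_set k = {real k ^ a / real l | a l. 1 \<le> a \<and> 1 \<le> l}"

record ('s, 'b) automaton =
  states :: "'s set"
  step :: "'s \<Rightarrow> nat \<Rightarrow> 's"
  start :: 's
  alphabet :: "'b set"
  out_map :: "'s \<Rightarrow> 'b"

definition is_k_automaton :: "nat \<Rightarrow> ('s, 'b) automaton \<Rightarrow> bool" where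
  "is_k_automaton k M \<longleftrightarrow>
     finite (states M) \<and> (\<forall>s\<in>states M. \<forall>i<k. step M s i \<in> states M) \<and>
     start M \<in> states M \<and> finite (alphabet M) \<and> (\<forall>s\<in>states M. out_map M s \<in> alphabet M)"

text \<open>
  The base-\<open>k\<close> digits of \<open>n\<close>, most significant first and without leading zeros; the word
  of \<open>0\<close> is \<open>[0]\<close>. The guard \<open>k < 2\<close> only serves termination.
\<close>

fun base_word :: "nat \<Rightarrow> nat \<Rightarrow> nat list" where
  "base_word k n = (if n < k \<or> k < 2 then [n] else base_word k (n div k) @ [n mod k])"

declare base_word.simps [simp del]

text \<open>State sets are finite, so taking the states to be natural numbers loses nothing.\<close>

definition k_automatic :: "nat \<Rightarrow> (nat \<Rightarrow> 'b) \<Rightarrow> bool" where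
  "k_automatic k a \<longleftrightarrow> (\<exists>M :: (nat, 'b) automaton. is_k_automaton k M \<and>
     (\<forall>n. a n = out_map M (foldl (step M) (start M) (base_word k n))))"

end

theory Submission
  imports Defs
begin

text \<open>
  Take \<open>\<xi> = \<Sum>\<^sub>j T\<^bsup>-\<nu>(j)\<^esup>\<close> where the ratios \<open>\<nu>(j+1)/\<nu>(j)\<close> lie in an interval
  \<open>[w\<^sub>0, w]\<close> with \<open>w\<^sub>0 = d(w-1)/(w-1-d)\<close> and equal \<open>w\<close> infinitely often. The truncations
  \<open>p\<^sub>j/q\<^sub>j\<close>, \<open>q\<^sub>j = T\<^bsup>\<nu>(j)\<^esup>\<close>, satisfy \<open>|\<xi> - p\<^sub>j/q\<^sub>j| = q\<^bsup>-\<nu>(j+1)\<^esup>\<close>, which gives the lower bounds.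
  For the upper bounds let \<open>P\<close> have degree at most \<open>d\<close> and height \<open>q\<^sup>h\<close>, and let \<open>j\<close> be minimal with
  \<open>h + d \<nu>(j) < \<nu>(j+1)\<close>. If \<open>P(p\<^sub>j/q\<^sub>j) \<noteq> 0\<close>, then \<open>|P(\<xi>)| = |P(p\<^sub>j/q\<^sub>j)| \<ge> q\<^bsup>-d\<nu>(j)\<^esup>\<close>, and minimality
  of \<open>j\<close> together with the choice of \<open>w\<^sub>0\<close> bounds this below by a constant times \<open>q\<^bsup>-h(w-1)\<^esup>\<close>.
  Otherwise \<open>q\<^sub>jX - p\<^sub>j\<close> divides \<open>P\<close>, and one concludes by induction on the degree. The hypothesis
  on \<open>w\<close> amounts to \<open>w\<^sub>0 < w\<close>. Letting \<open>\<nu>\<close> run through \<open>C\<^sub>i k\<^bsup>bj\<^esup>\<close> for finitely many \<open>C\<^sub>i\<close> makes the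
  sequence \<open>k\<close>-automatic; since \<open>w\<^sub>0 < w\<close>, a long enough cycle of \<open>C\<^sub>i\<close> exists for every rational \<open>w\<close>.
\<close>

section \<open>Extending the absolute value to the algebraic closure\<close>

definition is_subring :: "'b::field set \<Rightarrow> bool" where
  "is_subring A \<longleftrightarrow> 0 \<in> A \<and> 1 \<in> A \<and> (\<forall>x\<in>A. \<forall>y\<in>A. x - y \<in> A \<and> x * y \<in> A)"

lemma is_subringD:
  assumes "is_subring A"
  shows "0 \<in> A" "1 \<in> A" "x \<in> A \<Longrightarrow> y \<in> A \<Longrightarrow> x - y \<in> A" "x \<in> A \<Longrightarrow> y \<in> A \<Longrightarrow> x * y \<in> A"
    "x \<in> A \<Longrightarrow> - x \<in> A" "x \<in> A \<Longrightarrow> y \<in> A \<Longrightarrow> x + y \<in> A"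
proof -
  show z: "0 \<in> A" "1 \<in> A"
    and d: "\<And>x y. x \<in> A \<Longrightarrow> y \<in> A \<Longrightarrow> x - y \<in> A"
    and "\<And>x y. x \<in> A \<Longrightarrow> y \<in> A \<Longrightarrow> x * y \<in> A"
    using assms by (auto simp: is_subring_def)
  show m: "- x \<in> A" if "x \<in> A" for x using d[OF z(1) that] by simp
  show "x + y \<in> A" if "x \<in> A" "y \<in> A" for x y using d[OF that(1) m[OF that(2)]] by simp
qed

lemma subring_power: "is_subring A \<Longrightarrow> x \<in> A \<Longrightarrow> x ^ n \<in> A"
  by (induction n) (auto intro: is_subringD)

lemma subring_sum: "is_subring A \<Longrightarrow> (\<And>i. i \<in> I \<Longrightarrow> f i \<in> A) \<Longrightarrow> sum f I \<in> A"
  by (induction I rule: infinite_finite_induct) (auto intro: is_subringD)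

definition adjoin :: "'b::field set \<Rightarrow> 'b \<Rightarrow> 'b set" where
  "adjoin A x = {poly p x | p. \<forall>i. Polynomial.coeff p i \<in> A}"

lemma poly_altdef_le:
  assumes "Polynomial.degree p \<le> n"
  shows "poly p (x::'b::comm_semiring_1) = (\<Sum>i\<le>n. Polynomial.coeff p i * x ^ i)"
  unfolding poly_altdef
  by (rule sum.mono_neutral_left) (use assms in \<open>auto simp: coeff_eq_0\<close>)

lemma is_subring_adjoin:
  assumes "is_subring A"
  shows "is_subring (adjoin A x)"
  unfolding is_subring_def
proof (intro conjI ballI)
  note * = is_subringD(1,2)[OF assms]
  show "0 \<in> adjoin A x" unfolding adjoin_def using * by (auto intro!: exI[of _ 0])
  show "1 \<in> adjoin A x" unfolding adjoin_def using * by (auto intro!: exI[of _ 1] simp: coeff_1)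
  fix y z assume "y \<in> adjoin A x" "z \<in> adjoin A x"
  then obtain p q where pq: "\<forall>i. Polynomial.coeff p i \<in> A" "\<forall>i. Polynomial.coeff q i \<in> A"
    and yz: "y = poly p x" "z = poly q x" by (auto simp: adjoin_def)
  show "y - z \<in> adjoin A x"
    unfolding adjoin_def using pq yz by (auto intro!: exI[of _ "p - q"] is_subringD(3)[OF assms])
  show "y * z \<in> adjoin A x"
    unfolding adjoin_def using pq yz
    by (auto intro!: exI[of _ "p * q"] subring_sum[OF assms] is_subringD(4)[OF assms] simp: coeff_mult)
qed

lemma adjoin_contains:
  assumes "is_subring A"
  shows "A \<subseteq> adjoin A x" "x \<in> adjoin A x"
proof -
  note * = is_subringD[OF assms]
  show "A \<subseteq> adjoin A x"
    unfolding adjoin_def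
      using *(1) by (auto intro!: exI[of _ "[:_:]"] simp: coeff_pCons split: nat.split)
  show "x \<in> adjoin A x"
    unfolding adjoin_def using *(1,2)
    by (auto intro!: exI[of _ "[:0,1:]"] simp: coeff_pCons split: nat.split)
qed

text \<open>
  Chevalley's extension theorem in the case needed here: a subring that is maximal among those
  not containing \<open>t\<^sup>-\<^sup>1\<close> is a valuation ring, because \<open>x, x\<^sup>-\<^sup>1 \<notin> A\<close> would put \<open>t\<^sup>-\<^sup>1\<close> into both
  \<open>A[x]\<close> and \<open>A[x\<^sup>-\<^sup>1]\<close>, and the two relations of minimal degree reduce one another.
\<close>

locale maximal_subring =
  fixes A :: "'b::field set" and t :: 'b
  assumes subring: "is_subring A"
    and t_in: "t \<in> A" and t_nz: "t \<noteq> 0" and t_inv: "inverse t \<notin> A"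
    and maximal: "\<And>B. is_subring B \<Longrightarrow> A \<subseteq> B \<Longrightarrow> inverse t \<notin> B \<Longrightarrow> B = A"
begin

lemmas closed = is_subringD[OF subring] subring_power[OF subring] subring_sum[OF subring]

lemma inverse_t_in_adjoin: "x \<notin> A \<Longrightarrow> inverse t \<in> adjoin A x"
  using maximal[OF is_subring_adjoin[OF subring], of x] adjoin_contains[OF subring] by blast

text \<open>Let \<open>u = 1 - t * b\<close>. If \<open>inverse u\<close> were outside
  \<open>A\<close>, maximality would make \<open>inverse t\<close> a polynomial in
  \<open>inverse u\<close>. Multiplying by \<open>u ^ n\<close> clears denominators, and
  \<open>u ^ n\<close> has the form \<open>1 - t * c\<close> with \<open>c\<close> in
  \<open>A\<close>, so \<open>inverse t = inverse t * u ^ n + c\<close> would lie in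
  \<open>A\<close>.\<close>

lemma one_minus_t_invertible:
  assumes "b \<in> A"
  shows "1 - t * b \<noteq> 0" "inverse (1 - t * b) \<in> A"
proof -
  let ?u = "1 - t * b"
  have u: "?u \<in> A" using assms t_in by (intro closed)
  show nz: "?u \<noteq> 0"
  proof
    assume "?u = 0"
    hence "b = inverse t" using t_nz by (simp add: field_simps)
    thus False using assms t_inv by simp
  qed
  have one_minus_power: "\<exists>c\<in>A. ?u ^ n = 1 - t * c" for n
  proof (induction n)
    case 0 thus ?case using closed(1) by (auto intro!: bexI[of _ 0])
  next
    case (Suc n)
    then obtain c where c: "c \<in> A" "?u ^ n = 1 - t * c" by auto
    have "?u ^ Suc n = ?u * (1 - t * c)" by (simp add: c(2))
    also have "\<dots> = 1 - t * (c + b - t * b * c)" by (simp add: algebra_simps)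
    finally show ?case
      using c(1) assms t_in by (intro bexI[of _ "c + b - t * b * c"]) (auto intro!: closed(3,4,6))
  qed
  show "inverse ?u \<in> A"
  proof (rule ccontr)
    assume "inverse ?u \<notin> A"
    from inverse_t_in_adjoin[OF this] obtain p where
      p: "inverse t = poly p (inverse ?u)" "\<And>i. Polynomial.coeff p i \<in> A"
      by (auto simp: adjoin_def)
    define n where "n = Polynomial.degree p"
    have "inverse t * ?u ^ n = (\<Sum>i\<le>n. Polynomial.coeff p i * inverse ?u ^ i * ?u ^ n)"
      unfolding p(1) poly_altdef n_def by (simp add: sum_distrib_right)
    also have "\<dots> = (\<Sum>i\<le>n. Polynomial.coeff p i * ?u ^ (n - i))"
      by (rule sum.cong) (use nz in \<open>auto simp: power_diff field_simps\<close>)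
    finally have *: "inverse t * ?u ^ n = (\<Sum>i\<le>n. Polynomial.coeff p i * ?u ^ (n - i))" .
    have "inverse t * ?u ^ n \<in> A"
      unfolding * using p(2) u by (intro closed(8) closed(4)[OF _ closed(7)]) auto
    moreover obtain c where c: "c \<in> A" "?u ^ n = 1 - t * c" using one_minus_power by blast
    have "inverse t = inverse t * ?u ^ n + c" unfolding c(2) using t_nz by (simp add: field_simps)
    ultimately show False using closed(6) c(1) t_inv by metis
  qed
qed

text \<open>Descent on the sum of the two degree bounds. If \<open>m \<le> n\<close>, the second
  relation times \<open>x ^ n\<close> expresses \<open>x ^ n\<close> through lower powers, because
  its constant term leaves the unit \<open>1 - t * b\<close>; inserting this into the top term of
  \<open>p\<close> lowers \<open>n\<close>. At \<open>n = 0\<close> the first relation puts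
  \<open>inverse t\<close> into \<open>A\<close>.\<close>

lemma no_two_relations:
  assumes "x \<noteq> 0" "t * poly p x = 1" "t * poly q (inverse x) = 1"
    "\<And>i. Polynomial.coeff p i \<in> A" "\<And>i. Polynomial.coeff q i \<in> A"
    "Polynomial.degree p \<le> n" "Polynomial.degree q \<le> m"
  shows False
  using assms
proof (induction "n + m" arbitrary: x p q n m rule: less_induct)
  case less
  \<comment> \<open>Stated for free \<open>x\<close>, \<open>p\<close>, \<open>q\<close> so that it
    serves the case \<open>m \<le> n\<close> and, with \<open>inverse x\<close>, the opposite one;
    the induction hypothesis enters as the premise \<open>IH\<close>.\<close>
  have reduce: False
    if x: "x \<noteq> 0"
      and p: "t * poly p x = 1" "\<And>i. Polynomial.coeff p i \<in> A" "Polynomial.degree p \<le> n"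
    and q: "t * poly q (inverse x) = 1" "\<And>i. Polynomial.coeff q i \<in> A" "Polynomial.degree q \<le> m"
    and mn: "m \<le> n"
    and IH: "\<And>p'. n > 0 \<Longrightarrow> t * poly p' x = 1 \<Longrightarrow> (\<And>i. Polynomial.coeff p' i \<in> A) \<Longrightarrow>
      Polynomial.degree p' \<le> n - 1 \<Longrightarrow> False"
    for x p q n m
  proof (cases "n = 0")
    case True
    then obtain a where "p = [:a:]" using p(3) by (metis le_zero_eq degree_eq_zeroE)
    hence "inverse t = Polynomial.coeff p 0" using p(1) by (simp add: inverse_unique)
    thus False using p(2) t_inv by metis
  next
    case False
    define b where "b = Polynomial.coeff q 0"
    have bA: "b \<in> A" using q by (simp add: b_def)
    define u where "u = inverse (1 - t * b)"
    have u: "u \<in> A" "u * (1 - t * b) = 1"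
      using one_minus_t_invertible[OF bA] by (auto simp: u_def)
    \<comment> \<open>The non-constant part of \<open>q\<close> at \<open>inverse x\<close>,
      multiplied by \<open>x ^ n\<close>, is a polynomial in \<open>x\<close> of degree at most
      \<open>n - 1\<close>.\<close>
    define q' where "q' = (\<Sum>i\<in>{1..m}. monom (Polynomial.coeff q i) (n - i))"
    have q'A: "Polynomial.coeff q' i \<in> A" for i
      unfolding q'_def coeff_sum using q(2) closed(1) by (intro closed(8)) auto
    have dq': "Polynomial.degree q' \<le> n - 1"
      unfolding q'_def by (rule degree_sum_le) (auto intro: order.trans[OF degree_monom_le])
    have "poly q (inverse x) = (\<Sum>i\<le>m. Polynomial.coeff q i * inverse x ^ i)"
      using q(3) by (simp add: poly_altdef_le)
    also have "\<dots> = b + (\<Sum>i\<in>{1..m}. Polynomial.coeff q i * inverse x ^ i)"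
      by (simp add: b_def sum.atMost_shift sum.atLeast1_atMost_eq  lessThan_atLeast0)
    finally have "x ^ n * (poly q (inverse x) - b) = (\<Sum>i\<in>{1..m}. x ^ n * (Polynomial.coeff q i * inverse x ^ i))"
      by (simp add: sum_distrib_left)
    also have "\<dots> = poly q' x"
      unfolding q'_def poly_sum
      by (rule sum.cong) (use mn x in \<open>auto simp: poly_monom power_diff field_simps\<close>)
    finally have "t * poly q' x = x ^ n * (t * poly q (inverse x) - t * b)"
      by (simp add: algebra_simps)
    also have "\<dots> = x ^ n * (1 - t * b)" using q(1) by simp
    finally have key: "t * u * poly q' x = x ^ n"
      using u(2) by (metis mult.assoc mult.commute mult.right_neutral)
    define a where "a = Polynomial.coeff p n"
    define p1 where "p1 = p - monom a n"
    have dp1: "Polynomial.degree p1 \<le> n - 1"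
    proof (rule degree_le, intro allI impI)
      fix i assume "n - 1 < i"
      hence "i = n \<or> i > n" by auto
      thus "Polynomial.coeff p1 i = 0"
        using p(3) by (auto simp: p1_def a_def coeff_eq_0)
    qed
    have aA: "a \<in> A" using p by (simp add: a_def)
    define p2 where "p2 = p1 + Polynomial.smult (a * (t * u)) q'"
    show False
    proof (rule IH[of p2])
      show "n > 0" using False by simp
      have "poly p2 x = poly p1 x + a * (t * u * poly q' x)" by (simp add: p2_def mult.assoc)
      also have "\<dots> = poly p x" unfolding key by (simp add: p1_def poly_monom)
      finally show "t * poly p2 x = 1" using p(1) by simp
      show "Polynomial.coeff p2 i \<in> A" for i
        unfolding p2_def p1_def
          using p(2) q'A aA u(1) t_in closed(1) by (auto intro!: closed(3,4,6))
      show "Polynomial.degree p2 \<le> n - 1"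
        unfolding p2_def by (intro degree_add_le dp1 order.trans[OF degree_smult_le] dq')
    qed
  qed
  show ?case
  proof (cases "m \<le> n")
    case True
    show False
    proof (rule reduce[of x p n q m])
      fix p' assume *: "n > 0" "t * poly p' x = 1" "\<And>i. Polynomial.coeff p' i \<in> A"
        "Polynomial.degree p' \<le> n - 1"
      show False
        by (rule less.hyps[of "n - 1" m x p' q]) (use less.prems * in auto)
    qed (use less.prems True in auto)
  next
    case False
    show False
    proof (rule reduce[of "inverse x" q m p n])
      fix p' assume *: "m > 0" "t * poly p' (inverse x) = 1" "\<And>i. Polynomial.coeff p' i \<in> A"
        "Polynomial.degree p' \<le> m - 1"
      show False
        by (rule less.hyps[of n "m - 1" x p p']) (use less.prems * in auto)
    qed (use less.prems False in auto)
  qed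
qed

lemma valuation_ring: "x \<in> A \<or> inverse x \<in> A"
proof (rule ccontr)
  assume *: "\<not> ?thesis"
  hence "x \<noteq> 0" using closed(1) by auto
  from * obtain p q where
    "inverse t = poly p x" "\<And>i. Polynomial.coeff p i \<in> A"
    "inverse t = poly q (inverse x)" "\<And>i. Polynomial.coeff q i \<in> A"
    using inverse_t_in_adjoin[of x] inverse_t_in_adjoin[of "inverse x"]
    unfolding adjoin_def mem_Collect_eq by blast
  moreover have "t * inverse t = 1" using t_nz by simp
  ultimately show False
    using no_two_relations[OF \<open>x \<noteq> 0\<close>, of p q "Polynomial.degree p" "Polynomial.degree q"] by simp
qed

text \<open>Valuation rings are integrally closed: were \<open>y\<close> outside,
  \<open>inverse y\<close> would be in \<open>A\<close>, and dividing the relation by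
  \<open>y ^ (n - 1)\<close> would write \<open>y\<close> as an element of \<open>A\<close>.\<close>

lemma integral_imp_in:
  assumes "y ^ n = (\<Sum>i<n. e i * y ^ i)" "\<And>i. i < n \<Longrightarrow> e i \<in> A" "n > 0"
  shows "y \<in> A"
proof (rule ccontr)
  assume n: "y \<notin> A"
  hence z: "inverse y \<in> A" "y \<noteq> 0" using valuation_ring closed(1) by auto
  have "y = y ^ n * inverse y ^ (n - 1)"
    using z assms(3) by (cases n) (auto simp: field_simps)
  also have "\<dots> = (\<Sum>i<n. e i * inverse y ^ (n - 1 - i))"
    unfolding assms(1) sum_distrib_right
    by (rule sum.cong) (use z in \<open>auto simp: power_diff field_simps\<close>)
  also have "\<dots> \<in> A" using assms z by (intro closed) auto
  finally show False using n by simp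
qed

end

section \<open>From the valuation ring to a real-valued valuation\<close>

locale algebraic_valuation = maximal_subring A t for A :: "'b::field set" and t +
  assumes scaled_in: "\<exists>M. t ^ M * x \<in> A"
begin

definition slopes :: "'b \<Rightarrow> real set" where
  "slopes x = {of_int m / of_nat n | m n. n > 0 \<and> x ^ n * t powi (- m) \<in> A}"

text \<open>
  Every element lies between two powers of \<open>t\<close>, so the valuation has rank one and can be
  read off as the supremum of the rationals \<open>m/n\<close> with \<open>x\<^sup>n / t\<^sup>m \<in> A\<close>.
\<close>

definition val :: "'b \<Rightarrow> real" where "val x = Sup (slopes x)"

lemma slopesI: "n > 0 \<Longrightarrow> x ^ n * t powi (- m) \<in> A \<Longrightarrow> r = of_int m / of_nat n \<Longrightarrow> r \<in> slopes x"
  by (auto simp: slopes_def)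

lemma t_powi_in_iff: "t powi m \<in> A \<longleftrightarrow> m \<ge> 0"
proof
  assume *: "t powi m \<in> A"
  show "m \<ge> 0"
  proof (rule ccontr)
    assume "\<not> m \<ge> 0"
    then obtain n where m: "m = - int (Suc n)" by (metis int_cases not_le of_nat_0_le_iff)
    have "t powi m * t ^ n = inverse t"
      unfolding m power_int_minus using t_nz by (simp add: power_int_add field_simps)
    thus False using * t_in t_inv closed(4,7) by metis
  qed
next
  assume "m \<ge> 0"
  then obtain n where "m = int n" by (metis nonneg_int_cases)
  thus "t powi m \<in> A" using t_in closed(7) by simp
qed

lemma slopes_nonempty: "slopes x \<noteq> {}"
proof -
  obtain M where "t ^ M * x \<in> A" using scaled_in by blast
  hence "- real M \<in> slopes x" by (intro slopesI[of 1 _ "- int M"]) (auto simp: mult.commute)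
  thus ?thesis by auto
qed

text \<open>Apply \<open>scaled_in\<close> to \<open>inverse x\<close>: with the resulting
  \<open>M\<close>, a slope \<open>m / n\<close> of \<open>x\<close> forces
  \<open>t powi (M * n - m)\<close> into \<open>A\<close>, hence
  \<open>m / n \<le> M\<close>.\<close>

lemma slopes_bdd: "x \<noteq> 0 \<Longrightarrow> bdd_above (slopes x)"
proof -
  assume x: "x \<noteq> 0"
  obtain M where M: "t ^ M * inverse x \<in> A" using scaled_in by blast
  show ?thesis
  proof (rule bdd_aboveI[of _ "real M"])
    fix r assume "r \<in> slopes x"
    then obtain m :: int and n :: nat where
      r: "r = of_int m / of_nat n" "n > 0" "x ^ n * t powi (- m) \<in> A" by (auto simp: slopes_def)
    have "x ^ n * t powi (- m) * (t ^ M * inverse x) ^ n \<in> A" using r M closed(4,7) by blast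
    also have "x ^ n * t powi (- m) * (t ^ M * inverse x) ^ n = t powi (int (M * n) - m)"
      using x t_nz
        by (simp add: power_mult_distrib power_int_diff power_int_minus power_mult field_simps flip: of_nat_mult)
    finally have "m \<le> int (M * n)" by (simp add: t_powi_in_iff)
    hence "real_of_int m \<le> real M * real n"
      by (metis of_int_le_iff of_int_of_nat_eq of_nat_mult)
    thus "r \<le> real M" unfolding r(1) using r(2) by (simp add: divide_le_eq)
  qed
qed

lemma slopes_add:
  assumes "r \<in> slopes x" "s \<in> slopes y"
  shows "r + s \<in> slopes (x * y)"
proof -
  from assms obtain m :: int and n :: nat and m' :: int and n' :: nat where
    r: "r = of_int m / of_nat n" "n > 0" "x ^ n * t powi (- m) \<in> A" and
    s: "s = of_int m' / of_nat n'" "n' > 0" "y ^ n' * t powi (- m') \<in> A"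
    by (auto simp: slopes_def)
  have "(x ^ n * t powi (- m)) ^ n' * (y ^ n' * t powi (- m')) ^ n \<in> A"
    by (intro closed(4)[OF closed(7)[OF r(3)] closed(7)[OF s(3)]])
  also have "(x ^ n * t powi (- m)) ^ n' * (y ^ n' * t powi (- m')) ^ n
    = (x * y) ^ (n * n') * (t powi (- m * int n') * t powi (- m' * int n))"
    unfolding power_int_mult power_int_of_nat
    using power_mult[of x n n'] power_mult[of y n' n]
    by (simp add: power_mult_distrib mult_ac)
  also have "t powi (- m * int n') * t powi (- m' * int n) = t powi (- (m * int n' + m' * int n))"
    using t_nz by (subst power_int_add[symmetric]) (auto simp: algebra_simps)
  finally show ?thesis
    by (rule slopesI[rotated]) (use r(1,2) s(1,2) in \<open>auto simp: add_divide_distrib\<close>)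
qed

text \<open>Here the dichotomy of a valuation ring enters: the slopes of \<open>x\<close> and the
  negated slopes of \<open>inverse x\<close> together cover all rationals.\<close>

lemma slopes_inverse:
  assumes "n > 0" "of_int m / of_nat n \<notin> slopes x"
  shows "- (of_int m / of_nat n) \<in> slopes (inverse x)"
proof -
  have "x ^ n * t powi (- m) \<notin> A" using assms slopesI by blast
  hence "inverse (x ^ n * t powi (- m)) \<in> A" using valuation_ring by blast
  hence "inverse x ^ n * t powi (- (- m)) \<in> A" by (simp add: power_int_minus field_simps)
  thus ?thesis by (intro slopesI[of n _ "- m"]) (use assms in auto)
qed

lemma val_upper: "x \<noteq> 0 \<Longrightarrow> r \<in> slopes x \<Longrightarrow> r \<le> val x"
  unfolding val_def by (rule cSup_upper) (auto intro: slopes_bdd)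

lemma val_mult_ge:
  assumes "x \<noteq> 0" "y \<noteq> 0"
  shows "val x + val y \<le> val (x * y)"
proof -
  have "r + s \<le> val (x * y)" if "r \<in> slopes x" "s \<in> slopes y" for r s
    using val_upper[OF _ slopes_add[OF that]] assms by auto
  hence "val y \<le> val (x * y) - r" if "r \<in> slopes x" for r
    unfolding val_def[of y]
      using that by (intro cSup_least slopes_nonempty) (fastforce simp: le_diff_eq add.commute)
  hence "val x \<le> val (x * y) - val y"
    unfolding val_def[of x] by (intro cSup_least slopes_nonempty) (auto simp: algebra_simps)
  thus ?thesis by simp
qed

text \<open>A rational strictly between \<open>val x\<close> and \<open>- val (inverse x)\<close>
  would be neither a slope of \<open>x\<close> nor the negative of a slope of
  \<open>inverse x\<close>.\<close>

lemma val_inverse_ge: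
  assumes "x \<noteq> 0"
  shows "- val x \<le> val (inverse x)"
proof (rule ccontr)
  assume "\<not> ?thesis"
  hence "val x < - val (inverse x)" by simp
  then obtain q where q: "val x < of_rat q" "of_rat q < - val (inverse x)"
    using of_rat_dense by blast
  obtain m n where mn: "q = Rat.Fract m n" "n > 0" by (cases q) auto
  have q': "(of_rat q :: real) = of_int m / of_nat (nat n)"
    using mn by (simp add: of_rat_rat)
  have "of_int m / of_nat (nat n) \<notin> slopes x" using q(1) val_upper[OF assms] q' by force
  hence "- of_rat q \<in> slopes (inverse x)" using slopes_inverse[of "nat n" m x] mn q' by simp
  thus False using val_upper[of "inverse x"] assms q(2) by force
qed

lemma val_mult:
  assumes "x \<noteq> 0" "y \<noteq> 0"
  shows "val (x * y) = val x + val y"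
proof -
  have "val (x * y) + val (inverse y) \<le> val (x * y * inverse y)"
    using assms by (intro val_mult_ge) auto
  also have "x * y * inverse y = x" using assms by simp
  finally show ?thesis using val_inverse_ge[OF assms(2)] val_mult_ge[OF assms] by linarith
qed

lemma val_one: "val 1 = 0"
  using val_mult[of 1 1] by simp

lemma val_nonneg: "x \<in> A \<Longrightarrow> x \<noteq> 0 \<Longrightarrow> val x \<ge> 0"
  by (rule val_upper) (auto intro!: slopesI[of 1 _ 0])

text \<open>If \<open>x / y\<close> lies in \<open>A\<close>, then so does \<open>1 + x / y\<close>,
  and \<open>x + y = y * (1 + x / y)\<close>; otherwise \<open>x\<close> and \<open>y\<close>
  exchange roles.\<close>

lemma val_add_ge:
  assumes "x \<noteq> 0" "y \<noteq> 0" "x + y \<noteq> 0"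
  shows "min (val x) (val y) \<le> val (x + y)"
proof -
  have *: "val y \<le> val (x + y)"
    if "x * inverse y \<in> A" "y \<noteq> 0" "x + y \<noteq> 0" for x y
  proof -
    let ?z = "1 + x * inverse y"
    have e: "x + y = y * ?z" using that by (simp add: field_simps)
    hence "?z \<noteq> 0" using that by auto
    moreover have "?z \<in> A" using that by (intro closed(2,6))
    ultimately have "val (y * ?z) = val y + val ?z" "val ?z \<ge> 0"
      using that by (auto intro!: val_mult val_nonneg)
    thus ?thesis using e by simp
  qed
  consider "x * inverse y \<in> A" | "y * inverse x \<in> A"
    using valuation_ring[of "x * inverse y"] by (auto simp: mult.commute)
  thus ?thesis
  proof cases
    case 1 thus ?thesis using *[of x y] assms by auto
  next
    case 2 thus ?thesis using *[of y x] assms by (auto simp: add.commute)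
  qed
qed

text \<open>Every rational is a slope of 0, so \<open>val 0\<close> carries no information and the
  value at 0 is fixed separately.\<close>

lemma is_absolute_value_val:
  assumes "Q > 1"
  shows "is_absolute_value (\<lambda>x. if x = 0 then 0 else Q powr (- val x))"
  unfolding is_absolute_value_def
proof (intro conjI allI)
  fix x y
  let ?v = "\<lambda>x. if x = 0 then 0 else Q powr (- val x)"
  show "0 \<le> ?v x" "(?v x = 0) = (x = 0)" using assms by auto
  show "?v (x * y) = ?v x * ?v y"
    by (auto simp: val_mult powr_add[symmetric])
  show "?v (x + y) \<le> ?v x + ?v y"
  proof (cases "x = 0 \<or> y = 0 \<or> x + y = 0")
    case False
    hence "Q powr (- val (x + y)) \<le> Q powr (max (- val x) (- val y))"
      using val_add_ge[of x y] assms by (intro powr_mono) auto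
    also have "\<dots> \<le> Q powr (- val x) + Q powr (- val y)"
      by (auto simp: max_def)
    finally show ?thesis using False by simp
  qed (use assms in auto)
qed

end

section \<open>Existence of an extension of the absolute value\<close>

lemma exists_maximal_subring:
  fixes t :: "'b::field"
  assumes "is_subring R" "t \<in> R" "t \<noteq> 0" "inverse t \<notin> R"
  shows "\<exists>A. R \<subseteq> A \<and> maximal_subring A t"
proof -
  let ?S = "{B. is_subring B \<and> R \<subseteq> B \<and> inverse t \<notin> B}"
  \<comment> \<open>Zorn's lemma: the union of a chain of subrings that miss
    \<open>inverse t\<close> is again such a subring.\<close>
  have "\<exists>A\<in>?S. \<forall>B\<in>?S. A \<subseteq> B \<longrightarrow> B = A"
  proof (rule subset_Zorn_nonempty)
    show "?S \<noteq> {}" using assms by auto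
    fix C assume C: "C \<noteq> {}" "subset.chain ?S C"
    hence CS: "\<And>B. B \<in> C \<Longrightarrow> B \<in> ?S"
      and tot: "\<And>B D. B \<in> C \<Longrightarrow> D \<in> C \<Longrightarrow> B \<subseteq> D \<or> D \<subseteq> B"
      unfolding subset.chain_def by auto
    have "is_subring (\<Union>C)"
      unfolding is_subring_def
    proof (intro conjI ballI)
      show "0 \<in> \<Union>C" "1 \<in> \<Union>C" using C(1) CS is_subringD by blast+
      fix x y assume "x \<in> \<Union>C" "y \<in> \<Union>C"
      then obtain B D where "B \<in> C" "D \<in> C" "x \<in> B" "y \<in> D" by auto
      with tot[of B D] obtain E where "E \<in> C" "x \<in> E" "y \<in> E" by auto
      thus "x - y \<in> \<Union>C" "x * y \<in> \<Union>C"
        using CS[of E] is_subringD[of E] by blast+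
    qed
    thus "\<Union>C \<in> ?S" using CS C(1) by auto
  qed
  then obtain A where A: "A \<in> ?S" "\<And>B. B \<in> ?S \<Longrightarrow> A \<subseteq> B \<Longrightarrow> B = A"
    by auto
  have "maximal_subring A t"
    by unfold_locales (use A assms in auto)
  thus ?thesis using A by auto
qed

text \<open>Supplies one power of \<open>fls_X\<close> that clears the poles of all coefficients of
  a relation at once; the sum of the pole orders is a crude common bound.\<close>

lemma exists_fls_power_times_integral:
  fixes f :: "nat \<Rightarrow> 'a::field fls"
  shows "\<exists>M. \<forall>i<n. fls_X ^ M * f i = 0 \<or> fls_subdegree (fls_X ^ M * f i) \<ge> 0"
proof -
  define M where "M = (\<Sum>i<n. nat (- fls_subdegree (f i)))"
  have "fls_X ^ M * f i = 0 \<or> fls_subdegree (fls_X ^ M * f i) \<ge> 0" if "i < n" for i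
  proof -
    have "nat (- fls_subdegree (f i)) \<le> M"
      unfolding M_def using that by (intro member_le_sum) auto
    thus ?thesis by (cases "f i = 0") auto
  qed
  thus ?thesis by blast
qed

lemma card_field_ge2: "CARD('a::{finite,field}) \<ge> 2"
proof -
  have "card {0, 1 :: 'a} \<le> CARD('a)" by (intro card_mono) auto
  thus ?thesis by simp
qed

text \<open>Start from the power series ring \<open>R\<close> in \<open>t\<close>, the image of
  \<open>fls_X\<close>, enlarge it to a maximal subring \<open>A\<close> missing
  \<open>inverse t\<close>, and exponentiate the valuation of \<open>A\<close> with base
  \<open>CARD('a)\<close>.\<close>

lemma exists_extension_abs_fls:
  "\<exists>v :: 'a::{finite,field} fls alg_closure \<Rightarrow> real. is_absolute_value v \<and> (\<forall>\<xi>. v (to_ac \<xi>) = abs_fls \<xi>)"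
proof -
  define R :: "'a fls alg_closure set" where "R = to_ac ` {x. x = 0 \<or> fls_subdegree x \<ge> 0}"
  define t :: "'a fls alg_closure" where "t = to_ac fls_X"
  have R: "to_ac x \<in> R \<longleftrightarrow> x = 0 \<or> fls_subdegree x \<ge> 0"
    for x by (auto simp: R_def)
  have "is_subring R"
    unfolding is_subring_def
  proof (intro conjI ballI)
    show "0 \<in> R" "1 \<in> R" using R[of 0] R[of 1] by auto
    fix x y assume "x \<in> R" "y \<in> R"
    then obtain a b where ab: "x = to_ac a" "y = to_ac b" "a = 0 \<or> fls_subdegree a \<ge> 0"
      "b = 0 \<or> fls_subdegree b \<ge> 0" by (auto simp: R_def)
    have "a - b = 0 \<or> fls_subdegree (a - b) \<ge> 0"
      using ab(3,4) fls_subdegree_minus[of a b]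
        by (cases "a = 0"; cases "b = 0"; cases "a = b") auto
    thus "x - y \<in> R" using R[of "a - b"] ab by simp
    show "x * y \<in> R" using R[of "a * b"] ab by (cases "a = 0"; cases "b = 0") auto
  qed
  moreover have "t \<in> R" "t \<noteq> 0" using R[of fls_X] by (auto simp: t_def)
  moreover have "inverse t \<notin> R"
    using R[of "inverse fls_X"]
      unfolding t_def to_ac_inverse[symmetric] by (simp add: fls_inverse_X)
  ultimately obtain A where A: "R \<subseteq> A" "maximal_subring A t"
    using exists_maximal_subring by blast
  interpret maximal_subring A t by (rule A)
  interpret algebraic_valuation A t
  proof
    fix x :: "'a fls alg_closure"
    show "\<exists>M. t ^ M * x \<in> A"
    proof -
      obtain p where p: "p \<noteq> 0" "poly (map_poly to_ac p) x = 0"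
        by (rule alg_closure_algebraic)
      define n where "n = Polynomial.degree p"
      define c where "c = (\<lambda>i. - (Polynomial.coeff p i / lead_coeff p))"
      have lc: "lead_coeff p \<noteq> 0" using p by simp
      have "0 = (\<Sum>i\<le>n. to_ac (Polynomial.coeff p i) * x ^ i)"
        using p(2) by (simp add: poly_altdef n_def coeff_map_poly degree_map_poly)
      also have "\<dots> = (\<Sum>i<n. to_ac (Polynomial.coeff p i) * x ^ i) + to_ac (lead_coeff p) * x ^ n"
        by (simp add: n_def lessThan_Suc_atMost[symmetric])
      finally have "to_ac (lead_coeff p) * x ^ n = - (\<Sum>i<n. to_ac (Polynomial.coeff p i) * x ^ i)"
        by (metis add.commute eq_neg_iff_add_eq_0)
      hence "x ^ n = - (\<Sum>i<n. to_ac (Polynomial.coeff p i) * x ^ i) / to_ac (lead_coeff p)"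
        using lc by (metis nonzero_mult_div_cancel_left to_ac_eq_0_iff)
      also have "\<dots> = (\<Sum>i<n. to_ac (c i) * x ^ i)"
        by (simp add: c_def sum_negf sum_divide_distrib)
      finally have xn: "x ^ n = (\<Sum>i<n. to_ac (c i) * x ^ i)" .
      have n0: "n > 0"
      proof (rule ccontr)
        assume "\<not> n > 0"
        thus False using xn by simp
      qed
      obtain M where M: "\<And>i. i < n \<Longrightarrow> fls_X ^ M * c i = 0 \<or> fls_subdegree (fls_X ^ M * c i) \<ge> 0"
        using exists_fls_power_times_integral by blast
      \<comment> \<open>A monic relation for \<open>x\<close> with coefficients \<open>c i\<close>
        becomes one for \<open>t ^ M * x\<close> with coefficients
        \<open>t ^ (M * (n - i)) * c i\<close>. These lie in \<open>A\<close> because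
        \<open>n - i \<ge> 1\<close>.\<close>
      have "t ^ M * x \<in> A"
      proof (rule integral_imp_in[OF _ _ n0])
        show "(t ^ M * x) ^ n = (\<Sum>i<n. (t ^ (M * (n - i)) * to_ac (c i)) * (t ^ M * x) ^ i)"
          unfolding power_mult_distrib xn sum_distrib_left
        proof (rule sum.cong)
          fix i assume "i \<in> {..<n}"
          hence "(t ^ M) ^ n = (t ^ M) ^ (n - i) * (t ^ M) ^ i"
            by (simp flip: power_add)
          thus "(t ^ M) ^ n * (to_ac (c i) * x ^ i) = t ^ (M * (n - i)) * to_ac (c i) * ((t ^ M) ^ i * x ^ i)"
            by (simp add: power_mult mult_ac)
        qed auto
        fix i assume i: "i < n"
        have "to_ac (fls_X ^ M * c i) \<in> A" using M[OF i] R A(1) by blast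
        hence "t ^ M * to_ac (c i) \<in> A" by (simp add: t_def)
        hence "t ^ (M * (n - i - 1)) * (t ^ M * to_ac (c i)) \<in> A"
          by (rule closed(4)[OF closed(7)[OF t_in]])
        also have "t ^ (M * (n - i - 1)) * (t ^ M * to_ac (c i)) = t ^ (M * (n - i - 1) + M) * to_ac (c i)"
          by (simp add: power_add)
        also have "M * (n - i - 1) + M = M * (n - i)" using i
          by (metis Suc_diff_Suc add.commute diff_Suc_1 mult_Suc_right diff_diff_left Suc_eq_plus1)
        finally show "t ^ (M * (n - i)) * to_ac (c i) \<in> A" .
      qed
      thus ?thesis by blast
    qed
  qed
  \<comment> \<open>Dividing \<open>c\<close> by \<open>fls_X powi fls_subdegree c\<close> leaves a
    power series, so the subdegree is a slope. The same bound for \<open>inverse c\<close> then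
    yields equality, since the two valuations add up to 0.\<close>
  have ge: "val (to_ac c) \<ge> fls_subdegree c" if "c \<noteq> 0" for c
  proof (rule val_upper)
    have "fls_X powi (- fls_subdegree c) \<noteq> (0 :: 'a fls)"
      by (rule power_int_not_zero) simp
    hence "fls_subdegree (c * fls_X powi (- fls_subdegree c)) = 0"
      using that by (subst fls_subdegree_mult) auto
    hence "to_ac (c * fls_X powi (- fls_subdegree c)) \<in> A" using R A(1)
      by (metis order.refl subsetD)
    moreover have "to_ac (fls_X powi m) = t powi m" for m
      by (simp add: power_int_def t_def)
    ultimately have "to_ac c * t powi (- fls_subdegree c) \<in> A" by (metis to_ac_mult)
    thus "real_of_int (fls_subdegree c) \<in> slopes (to_ac c)"
      by (intro slopesI[of 1 _ "fls_subdegree c"]) auto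
  qed (use that in auto)
  have val: "val (to_ac c) = fls_subdegree c" if "c \<noteq> 0" for c
  proof -
    have "val (to_ac c * to_ac (inverse c)) = val (to_ac c) + val (to_ac (inverse c))"
      using that by (intro val_mult) auto
    moreover have "to_ac c * to_ac (inverse c) = 1" using that by simp
    moreover have "fls_subdegree (inverse c) = - fls_subdegree c"
      by (rule fls_inverse_subdegree)
    ultimately show ?thesis using ge[of c] ge[of "inverse c"] that val_one by simp
  qed
  have Q: "real CARD('a) > 1" using card_field_ge2[where 'a = 'a] by simp
  show ?thesis
  proof (intro exI conjI allI)
    show "is_absolute_value (\<lambda>x. if x = 0 then 0 else real CARD('a) powr (- val x))"
      by (rule is_absolute_value_val) (use Q in simp)
    show "(if to_ac c = 0 then 0 else real CARD('a) powr (- val (to_ac c))) = abs_fls c" for c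
    proof (cases "c = 0")
      case False
      have "real CARD('a) powr (- real_of_int (fls_subdegree c)) = real CARD('a) powr (real_of_int (- fls_subdegree c))"
        by simp
      also have "\<dots> = real CARD('a) powi (- fls_subdegree c)"
        using Q by (intro powr_real_of_int') auto
      finally show ?thesis using False val[OF False] by (simp add: abs_fls_def)
    qed (simp add: abs_fls_def)
  qed
qed

lemma abs_ac:
  "is_absolute_value (abs_ac :: 'a::{finite,field} fls alg_closure \<Rightarrow> real)"
  "abs_ac (to_ac \<xi>) = abs_fls (\<xi> :: 'a fls)"
  using someI_ex[OF exists_extension_abs_fls[where 'a = 'a]] unfolding abs_ac_def by auto

section \<open>Heights and minimal polynomials\<close>

lemma poly_map_poly_hom:
  fixes h :: "'b::comm_ring_1 \<Rightarrow> 'c::comm_ring_1"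
  assumes "h 0 = 0" "\<And>a b. h (a + b) = h a + h b" "\<And>a b. h (a * b) = h a * h b"
  shows "poly (map_poly h (p + q)) x = poly (map_poly h p) x + poly (map_poly h q) x"
    and "poly (map_poly h (p * q)) x = poly (map_poly h p) x * poly (map_poly h q) x"
proof -
  have add: "map_poly h (p + q) = map_poly h p + map_poly h q" for p q
    by (rule poly_eqI) (simp add: coeff_map_poly assms)
  show "poly (map_poly h (p + q)) x = poly (map_poly h p) x + poly (map_poly h q) x"
    by (simp add: add)
  have smult: "map_poly h (Polynomial.smult a q) = Polynomial.smult (h a) (map_poly h q)" for a q
    by (rule poly_eqI) (simp add: coeff_map_poly assms)
  show "poly (map_poly h (p * q)) x = poly (map_poly h p) x * poly (map_poly h q) x"
    by (induction p) (simp_all add: assms(1) add smult map_poly_pCons algebra_simps)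
qed

section \<open>The embedding of F_q[T] into the Laurent series\<close>

lemma fls_of_T_poly_0 [simp]: "fls_of_T_poly 0 = 0"
  and fls_of_T_poly_pCons: "fls_of_T_poly (pCons a c) = fls_const a + fls_X_inv * fls_of_T_poly c"
  by (simp_all add: fls_of_T_poly_def map_poly_pCons)

lemma fls_of_T_poly_add: "fls_of_T_poly (a + b) = fls_of_T_poly a + fls_of_T_poly b"
  and fls_of_T_poly_mult: "fls_of_T_poly (a * b) = fls_of_T_poly a * fls_of_T_poly b"
  unfolding fls_of_T_poly_def by (rule poly_map_poly_hom; simp add: fls_plus_const)+

lemma fls_of_T_poly_1 [simp]: "fls_of_T_poly 1 = 1"
  by (simp add: one_pCons fls_of_T_poly_pCons)

lemma fls_of_T_poly_power: "fls_of_T_poly (c ^ n) = fls_of_T_poly c ^ n"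
  by (induction n) (simp_all add: fls_of_T_poly_mult)

lemma fls_of_T_poly_minus: "fls_of_T_poly (- a) = - fls_of_T_poly a"
  using fls_of_T_poly_add[of a "- a"] by (simp add: add_eq_0_iff)

lemma fls_of_T_poly_sum: "fls_of_T_poly (sum f I) = (\<Sum>i\<in>I. fls_of_T_poly (f i))"
  by (induction I rule: infinite_finite_induct) (auto simp: fls_of_T_poly_add)

lemma fls_of_T_poly_monom: "fls_of_T_poly (monom 1 n) = fls_X_inv ^ n"
  by (induction n) (simp_all add: monom_0 monom_Suc fls_of_T_poly_pCons)

lemma fls_of_T_poly_nth:
  "fls_nth (fls_of_T_poly c) n = (if n \<le> 0 then Polynomial.coeff c (nat (- n)) else 0)"
proof (induction c arbitrary: n)
  case (pCons a c)
  have "nat (- n) = Suc (nat (- n - 1))" if "n < 0" using that by simp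
  thus ?case
    by (auto simp: fls_of_T_poly_pCons fls_X_inv_times_conv_shift pCons.IH coeff_pCons
        split: nat.split)
qed simp

lemma fls_of_T_poly_eq_0_iff [simp]: "fls_of_T_poly c = 0 \<longleftrightarrow> c = 0"
proof
  assume *: "fls_of_T_poly c = 0"
  show "c = 0"
  proof (rule poly_eqI)
    fix i show "Polynomial.coeff c i = Polynomial.coeff 0 i"
      using fls_of_T_poly_nth[of c "- int i"] * by simp
  qed
qed simp

lemma abs_fls_of_T_poly:
  assumes "c \<noteq> 0"
  shows "abs_fls (fls_of_T_poly (c :: 'a::{finite,field} poly)) = real CARD('a) ^ Polynomial.degree c"
proof -
  have "fls_subdegree (fls_of_T_poly c) = - int (Polynomial.degree c)"
    by (rule fls_subdegree_eqI) (use assms in \<open>auto simp: fls_of_T_poly_nth coeff_eq_0\<close>)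
  thus ?thesis using assms by (simp add: abs_fls_def)
qed

section \<open>The ultrametric absolute value\<close>

lemma abs_fls_0 [simp]: "abs_fls 0 = 0"
  and abs_fls_nonneg [simp]: "abs_fls x \<ge> 0"
  and abs_fls_eq_0_iff [simp]: "abs_fls x = 0 \<longleftrightarrow> x = 0"
  using card_field_ge2 by (auto simp: abs_fls_def)

lemma abs_fls_pos_iff [simp]: "abs_fls x > 0 \<longleftrightarrow> x \<noteq> 0"
  using abs_fls_nonneg[of x] abs_fls_eq_0_iff[of x] by linarith

lemma abs_fls_mult: "abs_fls (x * y) = abs_fls x * abs_fls (y :: 'a::{finite,field} fls)"
  using power_int_add[of "real CARD('a)" "- fls_subdegree x" "- fls_subdegree y"]
  by (simp add: abs_fls_def)

lemma abs_fls_1 [simp]: "abs_fls 1 = 1"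
  by (simp add: abs_fls_def)

lemma abs_fls_power: "abs_fls (x ^ n) = abs_fls x ^ n"
  by (induction n) (auto simp: abs_fls_mult)

lemma abs_fls_minus [simp]: "abs_fls (- x) = abs_fls x"
  by (simp add: abs_fls_def)

text \<open>The ultrametric inequality, with a common bound \<open>r\<close> in place of a maximum
  so that it chains through sums.\<close>

lemma abs_fls_add_le:
  assumes "abs_fls x \<le> r" "abs_fls y \<le> r"
  shows "abs_fls (x + y) \<le> r"
proof (cases "x = 0 \<or> y = 0 \<or> x + y = 0")
  case True
  thus ?thesis using assms abs_fls_nonneg[of x] by (auto simp del: abs_fls_nonneg)
next
  case False
  let ?Q = "real CARD('a)"
  have "?Q powi (- fls_subdegree (x + y)) \<le> ?Q powi (- min (fls_subdegree x) (fls_subdegree y))"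
    using fls_plus_subdegree[of x y] False card_field_ge2[where 'a = 'a]
      by (intro power_int_increasing) auto
  also have "\<dots> \<le> r" using assms False by (auto simp: abs_fls_def min_def)
  finally show ?thesis using False by (simp add: abs_fls_def)
qed

lemma abs_fls_add_less: "abs_fls x < r \<Longrightarrow> abs_fls y < r \<Longrightarrow> abs_fls (x + y) < r"
  using abs_fls_add_le[of x "max (abs_fls x) (abs_fls y)" y] by auto

lemma abs_fls_add_eq:
  assumes "abs_fls y < abs_fls x"
  shows "abs_fls (x + y) = abs_fls x"
proof -
  have "abs_fls (x + y) \<le> abs_fls x" using assms by (intro abs_fls_add_le) auto
  moreover have "\<not> abs_fls (x + y) < abs_fls x"
    using abs_fls_add_less[of "x + y" "abs_fls x" "- y"] assms by auto
  ultimately show ?thesis by simp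
qed

lemma abs_fls_sum_le: "(\<And>i. i \<in> I \<Longrightarrow> abs_fls (f i) \<le> r) \<Longrightarrow> r \<ge> 0 \<Longrightarrow> abs_fls (sum f I) \<le> r"
  by (induction I rule: infinite_finite_induct) (auto intro: abs_fls_add_le)

section \<open>Evaluation maps and heights\<close>

lemma eval_fls_0 [simp]: "eval_fls 0 x = 0"
  and eval_fls_pCons: "eval_fls (pCons a P) x = fls_of_T_poly a + x * eval_fls P x"
  by (simp_all add: eval_fls_def map_poly_pCons)

lemma eval_fls_mult: "eval_fls (P * R) x = eval_fls P x * eval_fls R x"
  unfolding eval_fls_def
  by (rule poly_map_poly_hom) (auto simp: fls_of_T_poly_add fls_of_T_poly_mult)

lemma eval_ac_0 [simp]: "eval_ac 0 x = 0"
  and eval_ac_pCons: "eval_ac (pCons a P) x = to_ac (fls_of_T_poly a) + x * eval_ac P x"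
  by (simp_all add: eval_ac_def map_poly_pCons)

lemma eval_ac_add: "eval_ac (P + R) x = eval_ac P x + eval_ac R x"
  and eval_ac_mult: "eval_ac (P * R) x = eval_ac P x * eval_ac R x"
  unfolding eval_ac_def
  by (rule poly_map_poly_hom; simp add: fls_of_T_poly_add fls_of_T_poly_mult)+

lemma eval_ac_smult: "eval_ac (Polynomial.smult a P) x = to_ac (fls_of_T_poly a) * eval_ac P x"
  using eval_ac_mult[of "[:a:]" P x] by (simp add: eval_ac_pCons)

lemma eval_ac_to_ac: "eval_ac P (to_ac x) = to_ac (eval_fls P x)"
  by (induction P) (simp_all add: eval_ac_pCons eval_fls_pCons)

lemma abs_coeff_le_height: "abs_fls (fls_of_T_poly (Polynomial.coeff P i)) \<le> height P"
proof (cases "i \<le> Polynomial.degree P")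
  case True
  thus ?thesis unfolding height_def by (intro Max_ge) auto
next
  case False
  have "(0::real) \<le> abs_fls (fls_of_T_poly (Polynomial.coeff P 0))" by simp
  also have "\<dots> \<le> height P" unfolding height_def by (intro Max_ge) auto
  finally show ?thesis using False by (simp add: coeff_eq_0)
qed

lemma height_attained: "\<exists>i\<le>Polynomial.degree P. height P = abs_fls (fls_of_T_poly (Polynomial.coeff P i))"
proof -
  have "height P \<in> (\<lambda>i. abs_fls (fls_of_T_poly (Polynomial.coeff P i))) ` {..Polynomial.degree P}"
    unfolding height_def by (intro Max_in) auto
  thus ?thesis by auto
qed

lemma height_eq_power:
  assumes "(P :: 'a::{finite,field} poly poly) \<noteq> 0"
  shows "\<exists>h. height P = real CARD('a) ^ h"
proof -
  have "0 < abs_fls (fls_of_T_poly (lead_coeff P))" using assms by simp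
  also have "\<dots> \<le> height P" by (rule abs_coeff_le_height)
  finally have "height P \<noteq> 0" by simp
  with height_attained[of P] show ?thesis
    by (metis abs_fls_of_T_poly abs_fls_0 fls_of_T_poly_0)
qed

lemma height_ge_1: "P \<noteq> 0 \<Longrightarrow> height P \<ge> 1"
  using height_eq_power[of P] card_field_ge2[where 'a = 'a] by (auto intro!: one_le_power)

lemma finite_bounded_degree_polys:
  assumes "finite F"
  shows "finite {P :: 'b::zero poly. Polynomial.degree P \<le> n \<and> (\<forall>i. Polynomial.coeff P i \<in> F)}"
proof (rule finite_subset)
  show "finite (Poly ` {xs. set xs \<subseteq> F \<and> length xs \<le> Suc n})"
    using assms by (intro finite_imageI finite_lists_length_le)
  show "{P. Polynomial.degree P \<le> n \<and> (\<forall>i. Polynomial.coeff P i \<in> F)}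
      \<subseteq> Poly ` {xs. set xs \<subseteq> F \<and> length xs \<le> Suc n}"
  proof
    fix P assume "P \<in> {P. Polynomial.degree P \<le> n \<and> (\<forall>i. Polynomial.coeff P i \<in> F)}"
    hence "set (coeffs P) \<subseteq> F \<and> length (coeffs P) \<le> Suc n"
      by (cases "P = 0") (auto simp: length_coeffs_degree coeffs_def)
    thus "P \<in> Poly ` {xs. set xs \<subseteq> F \<and> length xs \<le> Suc n}"
      by (metis (mono_tags, lifting) Poly_coeffs imageI mem_Collect_eq)
  qed
qed

text \<open>A Northcott property: over a finite field, bounded absolute values leave finitely many
  coefficients. Hence infinitely many approximations of bounded degree have unbounded height. The
  inequality \<open>e \<le> 2 ^ e\<close> bounds degrees without logarithms.\<close>

lemma finite_bounded_height:
  "finite {P :: 'a::{finite,field} poly poly. Polynomial.degree P \<le> n \<and> height P \<le> B}"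
proof (rule finite_subset)
  let ?F = "{c :: 'a poly. Polynomial.degree c \<le> nat \<lceil>B\<rceil> \<and> (\<forall>i. Polynomial.coeff c i \<in> UNIV)}"
  show "finite {P. Polynomial.degree P \<le> n \<and> (\<forall>i. Polynomial.coeff P i \<in> ?F)}"
    by (intro finite_bounded_degree_polys) auto
  show "{P. Polynomial.degree P \<le> n \<and> height P \<le> B}
      \<subseteq> {P. Polynomial.degree P \<le> n \<and> (\<forall>i. Polynomial.coeff P i \<in> ?F)}"
  proof safe
    fix P :: "'a poly poly" and i assume *: "height P \<le> B"
    show "Polynomial.degree (Polynomial.coeff P i) \<le> nat \<lceil>B\<rceil>"
    proof (cases "Polynomial.coeff P i = 0")
      case False
      let ?e = "Polynomial.degree (Polynomial.coeff P i)"
      have "real ?e \<le> 2 ^ ?e" using less_exp[of ?e] by (simp add: less_imp_le)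
      also have "\<dots> \<le> real CARD('a) ^ ?e"
        using card_field_ge2[where 'a = 'a] by (intro power_mono) auto
      also have "\<dots> \<le> B"
        using abs_coeff_le_height[of P i] abs_fls_of_T_poly[OF False] * by simp
      finally show ?thesis by linarith
    qed auto
  qed auto
qed

section \<open>Gauss's lemma and minimal polynomials\<close>

lemma exists_irreducible_divisor:
  fixes a :: "'a::field poly"
  assumes "Polynomial.degree a > 0"
  shows "\<exists>q. Factorial_Ring.irreducible q \<and> q dvd a"
  using assms
proof (induction "Polynomial.degree a" arbitrary: a rule: less_induct)
  case less
  show ?case
  proof (cases "Factorial_Ring.irreducible a")
    case False
    have "a \<noteq> 0" using less.prems by auto
    hence "\<not> is_unit a" using less.prems by (simp add: is_unit_iff_degree)
    with False \<open>a \<noteq> 0\<close> obtain b c where bc: "a = b * c" "\<not> is_unit b" "\<not> is_unit c"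
      by (auto simp: Factorial_Ring.irreducible_def)
    have nz: "b \<noteq> 0" "c \<noteq> 0" using bc \<open>a \<noteq> 0\<close> by auto
    hence "Polynomial.degree b > 0" "Polynomial.degree c > 0"
      using bc by (auto simp: is_unit_iff_degree)
    hence "Polynomial.degree b < Polynomial.degree a" using nz bc by (simp add: degree_mult_eq)
    with less.hyps[of b] \<open>Polynomial.degree b > 0\<close> bc show ?thesis by (meson dvd_mult2 dvd_trans dvd_triv_left)
  qed auto
qed

text \<open>Gauss's lemma: the irreducible factors \<open>q\<close> of \<open>a\<close> are removed
  one by one. The constant polynomial \<open>[:q:]\<close> is prime and cannot divide the primitive
  \<open>P\<close>, so it divides \<open>S\<close>.\<close>

lemma primitive_poly_dvd_cancel:
  fixes P Q S :: "'a::field poly poly"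
  assumes "primitive_poly P" "a \<noteq> 0" "Polynomial.smult a Q = P * S"
  shows "P dvd Q"
  using assms(2,3)
proof (induction "Polynomial.degree a" arbitrary: a S rule: less_induct)
  case less
  show ?case
  proof (cases "Polynomial.degree a = 0")
    case True
    then obtain b where b: "a * b = 1" using less.prems(1) is_unit_iff_degree[of a] by (metis dvdE)
    have "Q = Polynomial.smult b (Polynomial.smult a Q)" using b by (simp add: mult.commute)
    thus ?thesis unfolding less.prems(2) by (metis dvd_triv_left mult_smult_right)
  next
    case False
    then obtain q where q: "Factorial_Ring.irreducible q" "q dvd a"
      using exists_irreducible_divisor[of a] by blast
    then obtain a' where a': "a = q * a'" by blast
    have "q \<noteq> 0" "\<not> is_unit q" using q(1) by (auto simp: Factorial_Ring.irreducible_def)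
    hence dq: "Polynomial.degree q > 0" by (simp add: is_unit_iff_degree)
    have "prime_elem [:q:]"
      using q(1) field_poly_irreducible_imp_prime lift_prime_elem_poly by blast
    moreover have "[:q:] dvd P * S"
      unfolding less.prems(2)[symmetric] a'
        by (intro dvdI[of _ _ "Polynomial.smult a' Q"]) (simp add: mult.commute)
    ultimately have "[:q:] dvd P \<or> [:q:] dvd S" by (rule prime_elem_dvd_multD)
    moreover have "\<not> [:q:] dvd P"
      using assms(1) \<open>\<not> is_unit q\<close> by (auto simp: const_poly_dvd_iff primitive_poly_def)
    ultimately obtain S' where S': "S = [:q:] * S'" by blast
    have "Polynomial.smult q (Polynomial.smult a' Q) = Polynomial.smult q (P * S')"
      using less.prems(2) unfolding a' S' by (simp add: mult_ac)
    hence "[:q:] * Polynomial.smult a' Q = [:q:] * (P * S')" by (simp add: mult.commute)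
    hence "Polynomial.smult a' Q = P * S'" using \<open>q \<noteq> 0\<close> by (subst (asm) mult_cancel_left) simp
    moreover have "a' \<noteq> 0" using less.prems a' by auto
    moreover have "Polynomial.degree a' < Polynomial.degree a"
      using a' dq \<open>a' \<noteq> 0\<close> \<open>q \<noteq> 0\<close> by (simp add: degree_mult_eq)
    ultimately show ?thesis using less.hyps by blast
  qed
qed

text \<open>Pseudo-division leaves a remainder of lower degree that still annihilates
  \<open>\<alpha>\<close>, hence 0; the factor \<open>a\<close> it introduces is cancelled by
  primitivity.\<close>

lemma annihilator_dvd:
  assumes P: "P \<noteq> 0" "primitive_poly P" "eval_ac P \<alpha> = 0"
    and min: "\<And>R. R \<noteq> 0 \<Longrightarrow> eval_ac R \<alpha> = 0 \<Longrightarrow> Polynomial.degree P \<le> Polynomial.degree R"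
    and Q: "eval_ac Q \<alpha> = 0"
  shows "P dvd Q"
proof -
  obtain a S where a: "a \<noteq> 0" "Polynomial.smult a Q = P * S + pseudo_mod Q P"
    using pseudo_mod(1)[OF P(1)] by blast
  have "eval_ac (Polynomial.smult a Q) \<alpha> = eval_ac (P * S) \<alpha> + eval_ac (pseudo_mod Q P) \<alpha>"
    unfolding a(2) by (rule eval_ac_add)
  hence "eval_ac (pseudo_mod Q P) \<alpha> = 0" using P Q by (simp add: eval_ac_smult eval_ac_mult)
  hence "pseudo_mod Q P = 0"
    using min[of "pseudo_mod Q P"] pseudo_mod(2)[OF P(1), of Q] by force
  thus ?thesis using a primitive_poly_dvd_cancel[OF P(2), of a Q S] by simp
qed

abbreviation is_min_poly :: "'a::field poly poly \<Rightarrow> 'a fls alg_closure \<Rightarrow> bool" where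
  "is_min_poly P \<alpha> \<equiv> 0 < Polynomial.degree P \<and> Factorial_Ring.irreducible P \<and>
     primitive_poly P \<and> lead_coeff (lead_coeff P) = 1 \<and> eval_ac P \<alpha> = 0"

text \<open>Among the annihilators take the least degree in X, then the least degree in T of the
  leading coefficient. The second choice forces primitivity, since dividing out a non-constant
  content would lower it; the first, with primitivity, gives irreducibility and makes
  \<open>P\<close> divide every annihilator.\<close>

lemma ex1_min_poly:
  assumes "\<alpha> \<in> algebraic_over_FqT"
  shows "\<exists>!P. is_min_poly P \<alpha>"
proof -
  let ?ann = "\<lambda>P. P \<noteq> 0 \<and> eval_ac P \<alpha> = 0"
  obtain P0 where P0: "?ann P0" "\<And>R. ?ann R \<Longrightarrow> Polynomial.degree P0 \<le> Polynomial.degree R"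
    using assms ex_has_least_nat[of ?ann _ Polynomial.degree]
      unfolding algebraic_over_FqT_def by blast
  let ?ann' = "\<lambda>P. ?ann P \<and> Polynomial.degree P = Polynomial.degree P0"
  obtain P1 where P1: "?ann' P1" "\<And>R. ?ann' R \<Longrightarrow> Polynomial.degree (lead_coeff P1) \<le> Polynomial.degree (lead_coeff R)"
    using P0(1) ex_has_least_nat[of ?ann' P0 "\<lambda>P. Polynomial.degree (lead_coeff P)"]
      by blast
  define u where "u = inverse (lead_coeff (lead_coeff P1))"
  have u: "u \<noteq> 0"
    using P1(1) unfolding u_def by (metis leading_coeff_0_iff inverse_nonzero_iff_nonzero)
  define P where "P = Polynomial.smult [:u:] P1"
  have P: "P \<noteq> 0" "eval_ac P \<alpha> = 0" "Polynomial.degree P = Polynomial.degree P0"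
    "Polynomial.degree (lead_coeff P) = Polynomial.degree (lead_coeff P1)"
    using P1(1) u by (auto simp: P_def eval_ac_smult degree_mult_eq)
  have monic: "lead_coeff (lead_coeff P) = 1"
  proof -
    have "lead_coeff (lead_coeff P) = u * lead_coeff (lead_coeff P1)"
      by (simp add: P_def lead_coeff_mult)
    thus ?thesis using P1(1) unfolding u_def by (metis left_inverse leading_coeff_0_iff)
  qed
  have min: "\<And>R. ?ann R \<Longrightarrow> Polynomial.degree P \<le> Polynomial.degree R"
    using P0(2) P by simp
  have deg: "0 < Polynomial.degree P"
  proof (rule ccontr)
    assume "\<not> 0 < Polynomial.degree P"
    then obtain c where "P = [:c:]" by (metis degree_eq_zeroE gr0I)
    thus False using P by (simp add: eval_ac_pCons)
  qed
  have prim: "primitive_poly P"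
    unfolding primitive_poly_def
  proof (intro allI impI)
    fix c assume "\<forall>i. c dvd Polynomial.coeff P i"
    then obtain R where "P = [:c:] * R" unfolding const_poly_dvd_iff[symmetric] by blast
    hence R: "P = Polynomial.smult c R" by simp
    have "c \<noteq> 0" "R \<noteq> 0" using R P by auto
    hence "?ann' R" using R P by (auto simp: eval_ac_smult)
    hence "Polynomial.degree (lead_coeff P) \<le> Polynomial.degree (lead_coeff R)"
      using P1(2) P by simp
    hence "Polynomial.degree c = 0" using R \<open>c \<noteq> 0\<close> \<open>R \<noteq> 0\<close> by (simp add: degree_mult_eq)
    thus "c dvd 1" using \<open>c \<noteq> 0\<close> by (simp add: is_unit_iff_degree)
  qed
  have const_factor_unit: "is_unit B" if "P = A * B" "eval_ac A \<alpha> = 0" for A B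
  proof -
    have nz: "A \<noteq> 0" "B \<noteq> 0" using that P by auto
    hence "Polynomial.degree P \<le> Polynomial.degree A" using min that by blast
    hence "Polynomial.degree B = 0" using nz that by (simp add: degree_mult_eq)
    then obtain c where c: "B = [:c:]" by (metis degree_eq_zeroE)
    have "[:c:] dvd P" unfolding that(1) c by (rule dvd_triv_right)
    hence "c dvd 1" using prim by (auto simp: const_poly_dvd_iff primitive_poly_def)
    thus ?thesis using c by (simp add: is_unit_const_poly_iff)
  qed
  have irr: "Factorial_Ring.irreducible P"
  proof (rule Factorial_Ring.irreducibleI)
    show "P \<noteq> 0" by fact
    show "\<not> is_unit P" using deg by (auto simp: is_unit_poly_iff)
    fix A B assume AB: "P = A * B"
    hence "eval_ac A \<alpha> = 0 \<or> eval_ac B \<alpha> = 0" using P by (simp add: eval_ac_mult)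
    thus "is_unit A \<or> is_unit B"
      using const_factor_unit[of A B] const_factor_unit[of B A] AB by (auto simp: mult.commute)
  qed
  show ?thesis
  proof (rule ex1I[of _ P])
    show "is_min_poly P \<alpha>" using P deg prim irr monic by blast
    fix R assume R: "is_min_poly R \<alpha>"
    have "P dvd R" using annihilator_dvd[OF P(1) prim P(2)] min R by blast
    then obtain S where S: "R = P * S" by blast
    \<comment> \<open>The cofactor is thus a scalar \<open>e\<close> of F_q, and the two monic
      normalizations force \<open>e = 1\<close>.\<close>
    hence "is_unit S" using R irr by (metis Factorial_Ring.irreducible_def irreducibleD)
    then obtain c where c: "S = [:c:]" "is_unit c" by (auto simp: is_unit_poly_iff)
    then obtain e where e: "c = [:e:]" by (auto simp: is_unit_poly_iff)
    have "e = 1" using monic R unfolding S c e by (cases "e = 0") simp_all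
    thus "R = P" using S c e by (simp add: one_pCons[symmetric])
  qed
qed

lemma min_poly:
  assumes "\<alpha> \<in> algebraic_over_FqT"
  shows "is_min_poly (min_poly \<alpha>) \<alpha>"
  using theI'[OF ex1_min_poly[OF assms]] unfolding min_poly_def .

lemma min_poly_eqI:
  assumes "is_min_poly P \<alpha>"
  shows "min_poly \<alpha> = P" "\<alpha> \<in> algebraic_over_FqT"
proof -
  show "\<alpha> \<in> algebraic_over_FqT" unfolding algebraic_over_FqT_def mem_Collect_eq
    using assms by (intro exI[of _ P] conjI) auto
  from ex1_min_poly[OF this] assms show "min_poly \<alpha> = P"
    unfolding min_poly_def by (intro the1_equality) auto
qed

section \<open>Evaluation at rational points\<close>

text \<open>On the unit ball the ultrametric inequality lets no factor beyond the height
  appear.\<close>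

lemma eval_fls_Lipschitz:
  fixes x y :: "'a::{finite,field} fls"
  assumes "abs_fls x \<le> 1" "abs_fls y \<le> 1"
  shows "abs_fls (eval_fls P x - eval_fls P y) \<le> height P * abs_fls (x - y)"
proof -
  define H where "H = height P"
  have H: "H \<ge> 0"
    using order.trans[OF abs_fls_nonneg abs_coeff_le_height] unfolding H_def by blast
  \<comment> \<open>One bound \<open>H\<close> is kept for all tails \<open>R\<close> of
    \<open>P\<close>. The size at \<open>y\<close> is carried along because the difference of
    \<open>x * R(x)\<close> and \<open>y * R(y)\<close> produces the term
    \<open>(x - y) * R(y)\<close>.\<close>
  have "abs_fls (eval_fls R y) \<le> H \<and> abs_fls (eval_fls R x - eval_fls R y) \<le> H * abs_fls (x - y)"
    if "\<And>i. abs_fls (fls_of_T_poly (Polynomial.coeff R i)) \<le> H" for R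
    using that
  proof (induction R)
    case 0
    thus ?case using H by simp
  next
    case (pCons a R)
    have "abs_fls (fls_of_T_poly (Polynomial.coeff R i)) \<le> H"
      for i using pCons.prems[of "Suc i"] by simp
    note IH = pCons.IH[OF this]
    have a: "abs_fls (fls_of_T_poly a) \<le> H" using pCons.prems[of 0] by simp
    have "abs_fls (y * eval_fls R y) \<le> 1 * H" unfolding abs_fls_mult
      using assms IH H by (intro mult_mono) auto
    hence 1: "abs_fls (eval_fls (pCons a R) y) \<le> H"
      using a unfolding eval_fls_pCons by (intro abs_fls_add_le) auto
    have "abs_fls (x * (eval_fls R x - eval_fls R y)) \<le> 1 * (H * abs_fls (x - y))"
      unfolding abs_fls_mult using assms IH H by (intro mult_mono) auto
    moreover have "abs_fls ((x - y) * eval_fls R y) \<le> abs_fls (x - y) * H"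
      unfolding abs_fls_mult using IH by (intro mult_left_mono) auto
    ultimately have "abs_fls (x * (eval_fls R x - eval_fls R y) + (x - y) * eval_fls R y) \<le> H * abs_fls (x - y)"
      by (intro abs_fls_add_le) (auto simp: mult.commute)
    also have "x * (eval_fls R x - eval_fls R y) + (x - y) * eval_fls R y = eval_fls (pCons a R) x - eval_fls (pCons a R) y"
      by (simp add: eval_fls_pCons algebra_simps)
    finally show ?case using 1 by simp
  qed
  thus ?thesis using abs_coeff_le_height[of P] unfolding H_def by blast
qed

text \<open>Prepares a Liouville argument: nonzero elements of F_q[T] have absolute value at least
  1, so a nonzero value of \<open>P\<close> at \<open>p / q\<close> has absolute value at least
  \<open>1 / |q| ^ n\<close>.\<close>

lemma eval_fls_clear_denominator:
  assumes "q \<noteq> 0" "Polynomial.degree P \<le> n"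
  shows "\<exists>c. fls_of_T_poly c = fls_of_T_poly q ^ n * eval_fls P (fls_of_T_poly p / fls_of_T_poly q)"
  using assms(2)
proof (induction n arbitrary: P)
  case 0
  then obtain a where "P = [:a:]" by (metis degree_eq_zeroE le_zero_eq)
  thus ?case by (auto simp: eval_fls_pCons)
next
  case (Suc n)
  obtain a R where P: "P = pCons a R" by (cases P)
  have "Polynomial.degree R \<le> n" using Suc.prems P by (auto split: if_splits)
  then obtain c where c: "fls_of_T_poly c = fls_of_T_poly q ^ n * eval_fls R (fls_of_T_poly p / fls_of_T_poly q)"
    using Suc.IH by blast
  have "fls_of_T_poly (q ^ Suc n * a + p * c) = fls_of_T_poly q ^ Suc n * eval_fls P (fls_of_T_poly p / fls_of_T_poly q)"
    unfolding fls_of_T_poly_add fls_of_T_poly_mult fls_of_T_poly_power c P eval_fls_pCons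
    using assms(1) by (simp add: field_simps)
  thus ?case by blast
qed

text \<open>A nonzero constant term makes \<open>p\<close> coprime to T; one factor T is cancelled
  at a time.\<close>

lemma dvd_mult_monom_cancel:
  fixes p a :: "'a::field poly"
  assumes "Polynomial.coeff p 0 \<noteq> 0" "p dvd a * monom 1 n"
  shows "p dvd a"
  using assms(2)
proof (induction n)
  case 0
  thus ?case by (simp add: monom_0)
next
  case (Suc n)
  then obtain c where c: "a * monom 1 (Suc n) = p * c" by blast
  have "0 = Polynomial.coeff (a * monom 1 (Suc n)) 0" by (simp add: monom_Suc)
  hence "Polynomial.coeff c 0 = 0" using assms(1) unfolding c by (simp add: coeff_mult_0)
  then obtain c' where c': "c = pCons 0 c'" by (cases c) auto
  have "pCons 0 (a * monom 1 n) = pCons 0 (p * c')"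
    using c unfolding c' by (simp add: monom_Suc)
  hence "p dvd a * monom 1 n" by simp
  thus ?case by (rule Suc.IH)
qed

text \<open>As in the rational root theorem, the numerator \<open>p\<close>, coprime to the
  denominator, divides the constant coefficient of \<open>P\<close>. Subtracting a multiple of the
  linear factor then leaves X times a polynomial of smaller degree with the same root.\<close>

lemma rational_root_imp_dvd:
  fixes p :: "'a::field poly"
  assumes p: "Polynomial.coeff p 0 \<noteq> 0"
    and "eval_fls P (fls_of_T_poly p / fls_of_T_poly (monom 1 n)) = 0"
  shows "[:- p, monom 1 n:] dvd P"
  using assms(2)
proof (induction "Polynomial.degree P" arbitrary: P rule: less_induct)
  case less
  define q :: "'a poly" where "q = monom 1 n"
  define x where "x = fls_of_T_poly p / fls_of_T_poly q"
  have q: "q \<noteq> 0" by (simp add: q_def)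
  have p0: "p \<noteq> 0" using p by auto
  obtain a R where P: "P = pCons a R" by (cases P)
  have root: "fls_of_T_poly a + x * eval_fls R x = 0"
    using less.prems by (simp add: P eval_fls_pCons x_def q_def)
  show ?case
  proof (cases "R = 0")
    case True
    thus ?thesis using root P by simp
  next
    case False
    define N where "N = Polynomial.degree R"
    obtain c where c: "fls_of_T_poly c = fls_of_T_poly q ^ N * eval_fls R x"
      using eval_fls_clear_denominator[OF q, of R N p] unfolding N_def x_def by auto
    have "fls_of_T_poly (a * q ^ Suc N + p * c)
        = fls_of_T_poly q ^ Suc N * (fls_of_T_poly a + x * eval_fls R x)"
      unfolding fls_of_T_poly_add fls_of_T_poly_mult fls_of_T_poly_power c x_def
      using q by (simp add: field_simps)
    hence "a * q ^ Suc N = p * (- c)" using root by (simp add: add_eq_0_iff2)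
    hence "p dvd a * monom 1 (n * Suc N)"
      unfolding q_def by (metis dvd_triv_left monom_power power_one)
    then obtain b where b: "a = p * b" using dvd_mult_monom_cancel[OF p] by blast
    \<comment> \<open>Chosen so that \<open>P = (q * X - p) * (- b) + X * R'\<close>; as the root is
      nonzero, \<open>R'\<close> inherits it.\<close>
    define R' where "R' = R + [:q * b:]"
    have ev: "eval_fls R' x = eval_fls R x + fls_of_T_poly (q * b)"
      unfolding R'_def eval_fls_def
      by (subst poly_map_poly_hom(1)) (auto simp: fls_of_T_poly_add fls_of_T_poly_mult map_poly_pCons)
    have "x * fls_of_T_poly q = fls_of_T_poly p" using q by (simp add: x_def)
    hence "x * eval_fls R' x = fls_of_T_poly a + x * eval_fls R x"
      unfolding ev b fls_of_T_poly_mult by (metis add.commute distrib_left mult.assoc)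
    hence "x * eval_fls R' x = 0" using root by simp
    hence "eval_fls R' x = 0" using p0 q by (auto simp: x_def)
    moreover have "Polynomial.degree R' \<le> Polynomial.degree R"
      unfolding R'_def by (rule degree_add_le) auto
    ultimately have "[:- p, q:] dvd R'"
      using less.hyps[of R'] False unfolding P x_def q_def by simp
    moreover have "P = [:- p, q:] * [:- b:] + [:0, 1:] * R'"
      unfolding P b R'_def by (simp add: mult.commute)
    ultimately show ?thesis unfolding q_def by (metis dvd_add dvd_mult dvd_triv_left)
  qed
qed

text \<open>Let \<open>i\<close> be the largest index at which \<open>R\<close> attains its height.
  In coefficient \<open>Suc i\<close> of the product the term with \<open>q\<close> strictly
  dominates the one with \<open>p\<close>, since \<open>|p| \<le> |q|\<close> and coefficient
  \<open>Suc i\<close> of \<open>R\<close> is smaller than the height.\<close>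

lemma height_mult_linear:
  fixes p q :: "'a::{finite,field} poly"
  assumes "abs_fls (fls_of_T_poly p) \<le> abs_fls (fls_of_T_poly q)" "q \<noteq> 0" "R \<noteq> 0"
  shows "abs_fls (fls_of_T_poly q) * height R \<le> height ([:- p, q:] * R)"
proof -
  let ?r = "\<lambda>i. abs_fls (fls_of_T_poly (Polynomial.coeff R i))"
  let ?I = "{i. ?r i = height R}"
  have H: "height R > 0" using height_ge_1[OF assms(3)] by simp
  have "?I \<subseteq> {..Polynomial.degree R}"
    using H by (auto intro!: le_degree)
  hence fin: "finite ?I" by (rule finite_subset) simp
  have ne: "?I \<noteq> {}" using height_attained[of R] by force
  define i where "i = Max ?I"
  have i: "?r i = height R" using Max_in[OF fin ne] by (simp add: i_def)
  have "Suc i \<notin> ?I" using Max_ge[OF fin, of "Suc i"] by (auto simp: i_def)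
  hence "?r (Suc i) < height R" using abs_coeff_le_height[of R "Suc i"] by simp
  hence less: "abs_fls (fls_of_T_poly p) * ?r (Suc i) < abs_fls (fls_of_T_poly q) * height R"
    using assms(1,2)
      by (intro le_less_trans[OF mult_right_mono[OF assms(1)] mult_strict_left_mono]) auto
  have "Polynomial.coeff ([:- p, q:] * R) (Suc i) = q * Polynomial.coeff R i + (- p * Polynomial.coeff R (Suc i))"
    by simp
  hence "abs_fls (fls_of_T_poly (Polynomial.coeff ([:- p, q:] * R) (Suc i)))
    = abs_fls (fls_of_T_poly (q * Polynomial.coeff R i) + fls_of_T_poly (- p * Polynomial.coeff R (Suc i)))"
    by (simp only: fls_of_T_poly_add)
  also have "\<dots> = abs_fls (fls_of_T_poly (q * Polynomial.coeff R i))"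
    by (rule abs_fls_add_eq) (use less i in \<open>simp add: fls_of_T_poly_mult fls_of_T_poly_minus abs_fls_mult\<close>)
  also have "\<dots> = abs_fls (fls_of_T_poly q) * height R"
    by (simp add: fls_of_T_poly_mult abs_fls_mult i)
  finally show ?thesis using abs_coeff_le_height[of "[:- p, q:] * R" "Suc i"] by simp
qed

lemma absolute_value_triangle: "is_absolute_value v \<Longrightarrow> v (x + y) \<le> v x + v y"
  by (simp add: is_absolute_value_def)

lemma absolute_value_minus:
  assumes "is_absolute_value v"
  shows "v (- x) = v x"
proof -
  have m: "\<And>x y. v (x * y) = v x * v y"
    and n: "\<And>x. v x \<ge> 0" and z: "\<And>x. v x = 0 \<longleftrightarrow> x = 0"
    using assms by (auto simp: is_absolute_value_def)
  have "v (- 1) * v (- 1) = v 1" "v 1 * v 1 = v 1" using m[of "- 1" "- 1"] m[of 1 1] by auto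
  hence "v 1 = 1" using z[of 1] by simp
  hence "(v (- 1))\<^sup>2 = 1" using \<open>v (- 1) * v (- 1) = v 1\<close> by (simp add: power2_eq_square)
  hence "v (- 1) = 1" using n[of "- 1"] by (simp add: power2_eq_1_iff)
  thus ?thesis using m[of "- 1" x] by simp
qed

text \<open>For \<open>abs_ac\<close> the argument rests on the triangle inequality, so each degree
  costs a factor 3 = 1 + 2, with 2 the bound for \<open>|y|\<close>. This constant depends only on
  the degree bound and does not affect exponents.\<close>

lemma eval_ac_Lipschitz:
  fixes x y :: "'a::{finite,field} fls alg_closure"
  assumes "abs_ac x \<le> 1" "abs_ac y \<le> 2" "Polynomial.degree P \<le> n"
  shows "abs_ac (eval_ac P x - eval_ac P y) \<le> height P * 3 ^ Suc n * abs_ac (x - y)"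
proof -
  have v: "\<And>x y :: 'a fls alg_closure. abs_ac (x * y) = abs_ac x * abs_ac y"
    "\<And>x :: 'a fls alg_closure. abs_ac x \<ge> 0"
    "\<And>x y :: 'a fls alg_closure. abs_ac (x + y) \<le> abs_ac x + abs_ac y"
    using abs_ac(1)[where 'a = 'a] by (auto simp: is_absolute_value_def)
  define H where "H = height P"
  have H: "H \<ge> 0"
    using order.trans[OF abs_fls_nonneg abs_coeff_le_height] unfolding H_def by blast
  have "abs_ac (eval_ac R y) \<le> H * 3 ^ Suc n \<and>
    abs_ac (eval_ac R x - eval_ac R y) \<le> H * 3 ^ Suc n * abs_ac (x - y)"
    if "\<And>i. abs_fls (fls_of_T_poly (Polynomial.coeff R i)) \<le> H" "Polynomial.degree R \<le> n"
      for R n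
    using that
  proof (induction n arbitrary: R)
    case 0
    then obtain a where R: "R = [:a:]" by (metis degree_eq_zeroE le_zero_eq)
    have "abs_fls (fls_of_T_poly a) \<le> H" using 0(1)[of 0] R by simp
    moreover have "abs_ac (0 :: 'a fls alg_closure) = 0" using abs_ac(2)[of "0 :: 'a fls"] by simp
    ultimately show ?case using H v(2) by (simp add: R eval_ac_pCons abs_ac(2))
  next
    case (Suc n)
    obtain a R' where R: "R = pCons a R'" by (cases R)
    have "abs_fls (fls_of_T_poly (Polynomial.coeff R' i)) \<le> H"
      for i using Suc.prems(1)[of "Suc i"] R by simp
    moreover have "Polynomial.degree R' \<le> n" using Suc.prems(2) R by (auto split: if_splits)
    ultimately have IH: "abs_ac (eval_ac R' y) \<le> H * 3 ^ Suc n"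
      "abs_ac (eval_ac R' x - eval_ac R' y) \<le> H * 3 ^ Suc n * abs_ac (x - y)"
        using Suc.IH by blast+
    have a: "abs_fls (fls_of_T_poly a) \<le> H * 1" using Suc.prems(1)[of 0] R by simp
    also have "\<dots> \<le> H * 3 ^ Suc n"
      using H by (intro mult_left_mono) (simp_all del: power_Suc)
    finally have a: "abs_fls (fls_of_T_poly a) \<le> H * 3 ^ Suc n" .
    have "abs_ac (eval_ac R y) \<le> abs_ac (to_ac (fls_of_T_poly a)) + abs_ac y * abs_ac (eval_ac R' y)"
      unfolding R eval_ac_pCons using v(3) v(1) by metis
    also have "\<dots> \<le> H * 3 ^ Suc n + 2 * (H * 3 ^ Suc n)"
      using a IH assms v(2) H by (intro add_mono mult_mono) (auto simp: abs_ac(2))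
    finally have 1: "abs_ac (eval_ac R y) \<le> H * 3 ^ Suc (Suc n)" by simp
    have "eval_ac R x - eval_ac R y = x * (eval_ac R' x - eval_ac R' y) + (x - y) * eval_ac R' y"
      by (simp add: R eval_ac_pCons algebra_simps)
    hence "abs_ac (eval_ac R x - eval_ac R y)
        \<le> abs_ac x * abs_ac (eval_ac R' x - eval_ac R' y) + abs_ac (x - y) * abs_ac (eval_ac R' y)"
      using v(3) v(1) by metis
    also have "\<dots> \<le> 1 * (H * 3 ^ Suc n * abs_ac (x - y)) + abs_ac (x - y) * (H * 3 ^ Suc n)"
      using IH assms v(2) by (intro add_mono mult_mono) auto
    also have "\<dots> = 2 * (H * 3 ^ Suc n * abs_ac (x - y))" by simp
    also have "\<dots> \<le> 3 * (H * 3 ^ Suc n * abs_ac (x - y))"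
      using H v(2) by (intro mult_right_mono) auto
    finally show ?case using 1 by simp
  qed
  thus ?thesis using abs_coeff_le_height[of P] assms(3) unfolding H_def by blast
qed

lemma finite_min_poly_preimage:
  assumes "finite F"
  shows "finite {\<alpha> \<in> algebraic_over_FqT. min_poly \<alpha> \<in> F}"
proof (rule finite_subset)
  let ?ev = "\<lambda>P. map_poly (\<lambda>c. to_ac (fls_of_T_poly c)) P"
  show "{\<alpha> \<in> algebraic_over_FqT. min_poly \<alpha> \<in> F} \<subseteq> (\<Union>P\<in>F - {0}. {\<alpha>. poly (?ev P) \<alpha> = 0})"
    using min_poly unfolding eval_ac_def by force
  show "finite (\<Union>P\<in>F - {0}. {\<alpha>. poly (?ev P) \<alpha> = 0})"
  proof (intro finite_UN_I poly_roots_finite)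
    fix P assume "P \<in> F - {0}"
    thus "?ev P \<noteq> 0" by (subst map_poly_eq_0_iff) auto
  qed (use assms in auto)
qed

text \<open>\<open>w0_gt\<close> makes \<open>nu (Suc j) - d * nu j\<close> unbounded, so that every
  height admits a suitable index; \<open>gap\<close> converts the least such index into the exponent
  \<open>w - 1\<close>; \<open>ratio_le\<close> controls the linear factors split off on the way,
  and \<open>ratio_eq\<close> provides approximations of exactly that exponent.\<close>

locale lacunary =
  fixes nu :: "nat \<Rightarrow> nat" and w w0 :: real and d :: nat
  assumes strict_mono: "strict_mono nu" and nu_pos: "nu 0 > 0"
    and ratio_le: "\<And>j. real (nu (Suc j)) \<le> w * real (nu j)"
    and ratio_ge: "\<And>j. real (nu (Suc j)) \<ge> w0 * real (nu j)"
    and ratio_eq: "infinite {j. real (nu (Suc j)) = w * real (nu j)}"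
    and w_gt: "w > 1" and w0_gt: "w0 > real d"
    and gap: "real d \<le> (w - 1) * (1 - real d / w0)"
begin

section \<open>The series, its convergents and the lower bound for |P(xi)|\<close>

definition xi :: "'a::{finite,field} fls" where
  "xi = fps_to_fls (Abs_fps (\<lambda>n. if n \<in> range nu then 1 else 0))"

definition den :: "nat \<Rightarrow> 'a::{finite,field} poly" where
  "den j = monom 1 (nu j)"

definition num :: "nat \<Rightarrow> 'a::{finite,field} poly" where
  "num j = (\<Sum>i\<le>j. monom 1 (nu j - nu i))"

definition conv :: "nat \<Rightarrow> 'a::{finite,field} fls" where
  "conv j = fls_of_T_poly (num j) / fls_of_T_poly (den j)"

lemma nu_mono: "i \<le> j \<Longrightarrow> nu i \<le> nu j"
  using strict_mono by (simp add: strict_mono_less_eq)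

lemma nu_eq_iff: "nu i = nu j \<longleftrightarrow> i = j"
  using strict_mono by (simp add: strict_mono_eq)

lemma nu_ge: "j < nu j"
proof (induction j)
  case (Suc j)
  thus ?case using strict_monoD[OF strict_mono, of j "Suc j"] by simp
qed (rule nu_pos)

lemma conv_eq: "(conv j :: 'a::{finite,field} fls) = (\<Sum>i\<le>j. fls_X ^ nu i)"
proof -
  have "fls_X_inv ^ (nu j - nu i) = (fls_X ^ nu i * fls_X_inv ^ nu j :: 'a fls)"
    if "i \<le> j" for i
  proof -
    have "fls_X_inv ^ nu j = (fls_X_inv ^ nu i * fls_X_inv ^ (nu j - nu i) :: 'a fls)"
      using nu_mono[OF that] by (simp flip: power_add)
    moreover have "fls_X ^ nu i * fls_X_inv ^ nu i = (1 :: 'a fls)"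
      by (simp add: fls_inverse_X[symmetric] flip: power_mult_distrib)
    ultimately show ?thesis by (simp add: mult.assoc[symmetric])
  qed
  hence "fls_of_T_poly (num j) = (\<Sum>i\<le>j. fls_X ^ nu i) * (fls_X_inv ^ nu j :: 'a fls)"
    unfolding num_def fls_of_T_poly_sum fls_of_T_poly_monom sum_distrib_right
    by (intro sum.cong) auto
  thus ?thesis unfolding conv_def den_def fls_of_T_poly_monom
    by (metis fls_X_inv_pow_nonzero nonzero_mult_div_cancel_right)
qed

lemma abs_xi_minus_conv: "abs_fls (xi - conv j :: 'a::{finite,field} fls) = 1 / real CARD('a) ^ nu (Suc j)"
proof -
  have nth_sum: "fls_nth (sum f I) n = (\<Sum>i\<in>I. fls_nth (f i) n)"
    for f :: "nat \<Rightarrow> 'a fls" and I n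
    by (induction I rule: infinite_finite_induct) auto
  have conv: "fls_nth (conv j :: 'a fls) n = (if n \<in> int ` nu ` {..j} then 1 else 0)" for n
  proof -
    have "fls_nth (conv j :: 'a fls) n = (\<Sum>i\<le>j. if n = int (nu i) then 1 else 0)"
      unfolding conv_eq nth_sum by (intro sum.cong) auto
    also have "\<dots> = (if n \<in> int ` nu ` {..j} then 1 else 0)"
    proof (cases "n \<in> int ` nu ` {..j}")
      case True
      then obtain i where "n = int (nu i)" "i \<le> j" by auto
      thus ?thesis by (auto simp: nu_eq_iff)
    next
      case False
      thus ?thesis by (auto intro!: sum.neutral)
    qed
    finally show ?thesis .
  qed
  have xi: "fls_nth (xi :: 'a fls) n = (if n \<in> int ` range nu then 1 else 0)" for n
    unfolding xi_def by (cases n) (auto simp: image_iff)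
  have "fls_subdegree (xi - conv j :: 'a fls) = int (nu (Suc j))"
  proof (rule fls_subdegree_eqI)
    show "fls_nth (xi - conv j :: 'a fls) (int (nu (Suc j))) \<noteq> 0"
      by (auto simp: xi conv nu_eq_iff)
    fix n assume n: "n < int (nu (Suc j))"
    have "n \<in> int ` range nu \<longleftrightarrow> n \<in> int ` nu ` {..j}"
    proof
      assume "n \<in> int ` range nu"
      then obtain i where i: "n = int (nu i)" by auto
      hence "i < Suc j" using n strict_mono by (simp add: strict_mono_less)
      thus "n \<in> int ` nu ` {..j}" using i by auto
    qed auto
    thus "fls_nth (xi - conv j :: 'a fls) n = 0" by (simp add: xi conv)
  qed
  \<comment> \<open>The zero series has subdegree 0 by convention, whereas \<open>nu (Suc j)\<close>
    is positive.\<close>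
  moreover have "(xi - conv j :: 'a fls) \<noteq> 0"
    using calculation nu_ge[of "Suc j"] by auto
  ultimately show ?thesis by (simp add: abs_fls_def power_int_minus field_simps)
qed

lemma abs_conv_le: "abs_fls (conv j :: 'a::{finite,field} fls) \<le> 1"
  unfolding conv_eq
proof (rule abs_fls_sum_le)
  fix i
  have "abs_fls (fls_X ^ nu i :: 'a fls) = (1 / real CARD('a)) ^ nu i"
    by (simp add: abs_fls_power) (simp add: abs_fls_def power_int_minus field_simps)
  also have "\<dots> \<le> 1" using card_field_ge2[where 'a = 'a] by (intro power_le_one) auto
  finally show "abs_fls (fls_X ^ nu i :: 'a fls) \<le> 1" .
qed simp

lemma abs_xi_le: "abs_fls (xi :: 'a::{finite,field} fls) \<le> 1"
proof -
  have "abs_fls (conv 0 + (xi - conv 0) :: 'a fls) \<le> 1"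
    using card_field_ge2[where 'a = 'a]
    by (intro abs_fls_add_le abs_conv_le) (simp add: abs_xi_minus_conv divide_le_eq one_le_power)
  thus ?thesis by simp
qed

lemma den_nz: "(den j :: 'a::{finite,field} poly) \<noteq> 0" by (simp add: den_def)

lemma abs_den: "abs_fls (fls_of_T_poly (den j :: 'a::{finite,field} poly)) = real CARD('a) ^ nu j"
  using abs_fls_of_T_poly[OF den_nz[of j]] by (simp add: den_def degree_monom_eq)

lemma abs_num_le_den:
  "abs_fls (fls_of_T_poly (num j :: 'a::{finite,field} poly)) \<le> abs_fls (fls_of_T_poly (den j :: 'a poly))"
proof -
  have "fls_of_T_poly (num j) = conv j * fls_of_T_poly (den j :: 'a poly)"
    by (simp add: conv_def den_nz)
  hence "abs_fls (fls_of_T_poly (num j :: 'a poly)) = abs_fls (conv j :: 'a fls) * abs_fls (fls_of_T_poly (den j :: 'a poly))"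
    by (simp add: abs_fls_mult)
  also have "\<dots> \<le> 1 * abs_fls (fls_of_T_poly (den j :: 'a poly))"
    by (intro mult_right_mono abs_conv_le) simp
  finally show ?thesis by simp
qed

text \<open>Only \<open>i = j\<close> contributes. The constant term 1 makes \<open>num j\<close>
  coprime to \<open>den j\<close>, a power of T.\<close>

lemma coeff_num_0: "Polynomial.coeff (num j :: 'a::{finite,field} poly) 0 = 1"
proof -
  have "Polynomial.coeff (num j :: 'a poly) 0 = (\<Sum>i\<le>j. if i = j then 1 else 0)"
    unfolding num_def coeff_sum
  proof (rule sum.cong)
    fix i assume "i \<in> {..j}"
    hence "nu j - nu i = 0 \<longleftrightarrow> i = j"
      using nu_eq_iff[of i j] nu_mono[of i j] by auto
    thus "Polynomial.coeff (monom (1::'a) (nu j - nu i)) 0 = (if i = j then 1 else 0)" by simp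
  qed simp
  thus ?thesis by simp
qed

text \<open>The minimal polynomial of \<open>conv j\<close>. It serves both as a good approximation
  for \<open>w_exp\<close> and as the factor split off from a polynomial vanishing at
  \<open>conv j\<close>.\<close>

definition lin :: "nat \<Rightarrow> 'a::{finite,field} poly poly" where
  "lin j = [:- num j, den j:]"

lemma lin_nz: "(lin j :: 'a::{finite,field} poly poly) \<noteq> 0"
  and degree_lin: "Polynomial.degree (lin j :: 'a poly poly) = 1"
  by (auto simp: lin_def den_nz)

lemma abs_lin_xi: "abs_fls (eval_fls (lin j) (xi :: 'a::{finite,field} fls)) = real CARD('a) ^ nu j / real CARD('a) ^ nu (Suc j)"
proof -
  have "eval_fls (lin j) xi = fls_of_T_poly (den j) * (xi - conv j :: 'a fls)"
    using den_nz[of j, where 'a = 'a]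
      by (simp add: lin_def eval_fls_pCons fls_of_T_poly_minus conv_def algebra_simps)
  thus ?thesis by (simp add: abs_fls_mult abs_den abs_xi_minus_conv)
qed

lemma height_lin: "height (lin j :: 'a::{finite,field} poly poly) = real CARD('a) ^ nu j"
proof -
  have "{..Polynomial.degree (lin j :: 'a poly poly)} = {0, 1}"
    unfolding degree_lin by auto
  thus ?thesis using abs_num_le_den[of j, where 'a = 'a]
    unfolding height_def by (simp add: lin_def fls_of_T_poly_minus abs_den den_nz)
qed

text \<open>A factor \<open>lin j\<close> satisfies the bound with constant 1 by
  \<open>ratio_le\<close>, so the constant does not deteriorate in the induction on the degree. The
  term \<open>d * nu 0\<close> covers \<open>j = 0\<close>, where minimality of the index gives
  nothing.\<close>

lemma abs_eval_xi_ge: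
  assumes "P \<noteq> 0" "Polynomial.degree P \<le> d"
  shows "height P powr (- (w - 1)) / real CARD('a) ^ (d * nu 0) \<le> abs_fls (eval_fls P (xi :: 'a::{finite,field} fls))"
  using assms
proof (induction "Polynomial.degree P" arbitrary: P rule: less_induct)
  case less
  let ?Q = "real CARD('a)"
  have Q: "?Q > 1" using card_field_ge2[where 'a = 'a] by simp
  obtain h where h: "height P = ?Q ^ h" using height_eq_power[OF less.prems(1)] by blast
  \<comment> \<open>The difference \<open>nu (Suc j) - d * nu j\<close> is at least
    \<open>(w0 - d) * j\<close> and so outgrows \<open>h\<close>.\<close>
  have "\<exists>j. h + d * nu j < nu (Suc j)"
  proof -
    obtain j :: nat where j: "real h / (w0 - d) < real j" using reals_Archimedean2 by blast
    have "real h < (w0 - d) * real j" using j w0_gt by (simp add: field_simps)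
    also have "\<dots> \<le> (w0 - d) * real (nu j)"
      using w0_gt nu_ge[of j] by (intro mult_left_mono) auto
    also have "\<dots> \<le> real (nu (Suc j)) - d * real (nu j)"
      using ratio_ge[of j] by (simp add: algebra_simps)
    finally have "real (h + d * nu j) < real (nu (Suc j))" by simp
    thus ?thesis by (intro exI[of _ j]) linarith
  qed
  hence ex: "\<exists>j. h + d * nu j < nu (Suc j) \<and> (\<forall>i<j. \<not> h + d * nu i < nu (Suc i))"
    using exists_least_iff[of "\<lambda>j. h + d * nu j < nu (Suc j)"] by blast
  then obtain j where j: "h + d * nu j < nu (Suc j)" and
    least: "\<And>i. i < j \<Longrightarrow> nu (Suc i) \<le> h + d * nu i" by (auto simp: not_less)
  show ?case
  proof (cases "eval_fls P (conv j) = 0")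
    case False
    \<comment> \<open>Liouville: \<open>c\<close> is a nonzero element of F_q[T], which keeps
      \<open>P(conv j)\<close> away from 0.\<close>
    obtain c where c: "fls_of_T_poly c = fls_of_T_poly (den j) ^ d * eval_fls P (conv j)"
      using eval_fls_clear_denominator[OF den_nz[of j] less.prems(2), of "num j"]
        unfolding conv_def by blast
    have "c \<noteq> 0"
      using c False den_nz[of j] by (metis fls_of_T_poly_eq_0_iff mult_eq_0_iff power_not_zero)
    hence "1 \<le> abs_fls (fls_of_T_poly c)" using Q by (simp add: abs_fls_of_T_poly one_le_power)
    also have "\<dots> = ?Q ^ (d * nu j) * abs_fls (eval_fls P (conv j))"
      unfolding c
        by (simp add: abs_fls_mult abs_fls_power abs_den power_mult[symmetric] mult.commute)
    finally have val: "1 / ?Q ^ (d * nu j) \<le> abs_fls (eval_fls P (conv j))"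
      using Q by (simp add: field_simps)
    \<comment> \<open>By the choice of \<open>j\<close>, replacing \<open>xi\<close> by
      \<open>conv j\<close> costs strictly less than the Liouville bound, so both values have the
      same size.\<close>
    have "abs_fls (eval_fls P xi - eval_fls P (conv j)) \<le> ?Q ^ h * (1 / ?Q ^ nu (Suc j))"
      using eval_fls_Lipschitz[OF abs_xi_le abs_conv_le, of P j] by (simp add: h abs_xi_minus_conv)
    also have "\<dots> < 1 / ?Q ^ (d * nu j)"
    proof -
      have "?Q ^ (h + d * nu j) < ?Q ^ nu (Suc j)" using j Q by (intro power_strict_increasing)
      thus ?thesis using Q by (simp add: field_simps power_add)
    qed
    also note val
    finally have "abs_fls (eval_fls P (conv j) + (eval_fls P xi - eval_fls P (conv j))) = abs_fls (eval_fls P (conv j))"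
      by (rule abs_fls_add_eq)
    hence eq: "abs_fls (eval_fls P xi) = abs_fls (eval_fls P (conv j))" by simp
    \<comment> \<open>For \<open>j = i + 1\<close>, minimality gives
      \<open>nu j \<le> h + d * nu i \<le> h + d * nu j / w0\<close>; multiplied by
      \<open>w - 1\<close>, this and \<open>gap\<close> bound \<open>d * nu j\<close> by
      \<open>h * (w - 1)\<close>.\<close>
    have le: "real (d * nu j) \<le> real h * (w - 1) + real (d * nu 0)"
    proof (cases j)
      case 0
      thus ?thesis using w_gt by simp
    next
      case (Suc i)
      have "real (nu j) \<le> real h + d * real (nu i)"
        using least[of i] Suc by (metis lessI of_nat_add of_nat_le_iff of_nat_mult)
      moreover have "real (nu i) \<le> real (nu j) / w0"
        using ratio_ge[of i] Suc w0_gt by (simp add: field_simps)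
      hence "d * real (nu i) \<le> d * (real (nu j) / w0)" by (intro mult_left_mono) auto
      ultimately have "real (nu j) * (1 - d / w0) \<le> real h" by (simp add: algebra_simps)
      hence "(w - 1) * (real (nu j) * (1 - d / w0)) \<le> (w - 1) * real h"
        using w_gt by (intro mult_left_mono) auto
      moreover have "d * real (nu j) \<le> ((w - 1) * (1 - d / w0)) * real (nu j)"
        using gap by (intro mult_right_mono) auto
      ultimately have "d * real (nu j) \<le> real h * (w - 1)" by (simp add: algebra_simps)
      thus ?thesis unfolding of_nat_mult by (intro add_increasing2) auto
    qed
    have pw: "?Q ^ n = ?Q powr real n" for n using Q by (simp add: powr_realpow)
    have "height P powr (- (w - 1)) / ?Q ^ (d * nu 0) = ?Q powr (- (real h * (w - 1) + real (d * nu 0)))"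
      unfolding h pw by (simp add: powr_powr powr_diff[symmetric] algebra_simps del: of_nat_mult)
    also have "\<dots> \<le> ?Q powr (- real (d * nu j))" using le Q by (intro powr_mono) auto
    also have "\<dots> = 1 / ?Q ^ (d * nu j)" unfolding pw by (simp add: powr_minus field_simps)
    also note val
    finally show ?thesis using eq by simp
  next
    case True
    hence "lin j dvd P"
      unfolding lin_def den_def
      by (intro rational_root_imp_dvd) (auto simp: coeff_num_0 conv_def den_def)
    then obtain R where R: "P = lin j * R" by blast
    have R0: "R \<noteq> 0" using R less.prems by auto
    have dR: "Polynomial.degree P = Suc (Polynomial.degree R)"
      using R R0 by (simp add: degree_mult_eq lin_nz degree_lin)
    have IH: "height R powr (- (w - 1)) / ?Q ^ (d * nu 0) \<le> abs_fls (eval_fls R (xi :: 'a fls))"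
      using less.hyps[of R] R0 dR less.prems by simp
    have hR: "height R \<ge> 1" by (rule height_ge_1[OF R0])
    have HP: "?Q ^ nu j * height R \<le> height P"
      using height_mult_linear[OF abs_num_le_den den_nz R0, of j]
        unfolding R lin_def by (simp add: abs_den)
    have pw: "?Q ^ n = ?Q powr real n" for n using Q by (simp add: powr_realpow)
    \<comment> \<open>A lower bound for the height of the product suffices because the exponent
      \<open>- (w - 1)\<close> is negative.\<close>
    have "height P powr (- (w - 1)) \<le> (?Q ^ nu j * height R) powr (- (w - 1))"
      using w_gt HP hR Q by (intro powr_mono2') auto
    also have "\<dots> = (?Q ^ nu j) powr (- (w - 1)) * height R powr (- (w - 1))"
      by (rule powr_mult)
    also have "(?Q ^ nu j) powr (- (w - 1)) \<le> ?Q ^ nu j / ?Q ^ nu (Suc j)"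
    proof -
      have "(?Q ^ nu j) powr (- (w - 1)) = ?Q powr (real (nu j) - w * real (nu j))"
        unfolding pw by (simp add: powr_powr algebra_simps)
      also have "\<dots> \<le> ?Q powr (real (nu j) - real (nu (Suc j)))"
        using ratio_le[of j] Q by (intro powr_mono) auto
      also have "\<dots> = ?Q ^ nu j / ?Q ^ nu (Suc j)" unfolding pw by (simp add: powr_diff)
      finally show ?thesis .
    qed
    finally have "height P powr (- (w - 1)) / ?Q ^ (d * nu 0)
        \<le> (?Q ^ nu j / ?Q ^ nu (Suc j) * height R powr (- (w - 1))) / ?Q ^ (d * nu 0)"
      using Q by (intro divide_right_mono) (auto simp: mult_right_mono)
    also have "\<dots> = (?Q ^ nu j / ?Q ^ nu (Suc j)) * (height R powr (- (w - 1)) / ?Q ^ (d * nu 0))"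
      by simp
    also have "\<dots> \<le> (?Q ^ nu j / ?Q ^ nu (Suc j)) * abs_fls (eval_fls R (xi :: 'a fls))"
      using IH Q by (intro mult_left_mono) auto
    also have "\<dots> = abs_fls (eval_fls P (xi :: 'a fls))"
      unfolding R eval_fls_mult abs_fls_mult abs_lin_xi by simp
    finally show ?thesis .
  qed
qed

end

section \<open>Exponents of lacunary series\<close>

context lacunary begin

text \<open>As \<open>v > w - 1\<close>, the lower bound for \<open>|P(xi)|\<close> and the assumed
  upper bound are compatible only up to an explicit height. The factor \<open>C\<close> leaves room
  for the Lipschitz constant on the algebraic closure.\<close>

lemma height_bounded_of_small_value:
  assumes "P \<noteq> 0" "Polynomial.degree P \<le> d" "v > w - 1"
    and "abs_fls (eval_fls P (xi :: 'a::{finite,field} fls)) \<le> C * height P powr (- v)" "C > 0"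
  shows "height P \<le> (C * real CARD('a) ^ (d * nu 0)) powr (1 / (v - (w - 1)))"
proof -
  let ?Q = "real CARD('a)"
  have Q: "?Q > 1" using card_field_ge2[where 'a = 'a] by simp
  have H: "height P \<ge> 1" by (rule height_ge_1) fact
  have "height P powr (- (w - 1)) / ?Q ^ (d * nu 0) \<le> C * height P powr (- v)"
    using abs_eval_xi_ge[OF assms(1,2)] assms(4) by linarith
  hence "height P powr (- (w - 1)) \<le> C * ?Q ^ (d * nu 0) * height P powr (- v)"
    using Q by (simp add: field_simps)
  hence "height P powr v * height P powr (- (w - 1)) \<le> height P powr v * (C * ?Q ^ (d * nu 0) * height P powr (- v))"
    by (intro mult_left_mono) auto
  also have "\<dots> = C * ?Q ^ (d * nu 0) * (height P powr v * height P powr (- v))" by simp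
  also have "height P powr v * height P powr (- v) = 1" using H by (simp add: powr_add[symmetric])
  finally have "height P powr (v - (w - 1)) \<le> C * ?Q ^ (d * nu 0)"
    by (simp add: powr_add[symmetric] algebra_simps)
  hence "(height P powr (v - (w - 1))) powr (1 / (v - (w - 1))) \<le> (C * ?Q ^ (d * nu 0)) powr (1 / (v - (w - 1)))"
    using assms(3) by (intro powr_mono2) auto
  thus ?thesis using assms(3) H by (simp add: powr_powr)
qed

lemma den_powr:
  assumes "real (nu (Suc j)) = w * real (nu j)"
  shows "1 / real CARD('a::{finite,field}) ^ nu (Suc j) = (real CARD('a) ^ nu j) powr (- w)"
proof -
  have pw: "real CARD('a) ^ n = real CARD('a) powr real n" for n
    using card_field_ge2[where 'a = 'a] by (simp add: powr_realpow)
  show ?thesis unfolding pw by (simp add: powr_powr assms powr_minus field_simps)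
qed

lemma inj_lin: "inj (lin :: nat \<Rightarrow> 'a::{finite,field} poly poly)"
proof (rule injI)
  fix i j assume "(lin i :: 'a poly poly) = lin j"
  hence "(den i :: 'a poly) = den j" by (simp add: lin_def)
  hence "Polynomial.degree (den i :: 'a poly) = Polynomial.degree (den j :: 'a poly)" by simp
  thus "i = j" by (simp add: den_def degree_monom_eq nu_eq_iff)
qed

text \<open>Any \<open>v > w - 1\<close> confines \<open>P\<close> to bounded height, hence to a
  finite set. The polynomials \<open>lin j\<close> at the indices of \<open>ratio_eq\<close> attain
  \<open>w - 1\<close> itself.\<close>

lemma w_exp_xi:
  assumes "1 \<le> n" "n \<le> d"
  shows "w_exp n (xi :: 'a::{finite,field} fls) = ereal (w - 1)"
  unfolding w_exp_def
proof (rule antisym)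
  let ?Q = "real CARD('a)"
  have Q: "?Q > 1" using card_field_ge2[where 'a = 'a] by simp
  let ?S = "\<lambda>v. {P. Polynomial.degree P \<le> n \<and> 0 < abs_fls (eval_fls P (xi :: 'a fls)) \<and>
    abs_fls (eval_fls P (xi :: 'a fls)) \<le> height P powr (- v)}"
  show "Sup {ereal v | v. infinite (?S v)} \<le> ereal (w - 1)"
  proof (rule Sup_least, clarify)
    fix v assume inf: "infinite (?S v)"
    show "ereal v \<le> ereal (w - 1)"
    proof (rule ccontr)
      assume "\<not> ?thesis"
      hence v: "v > w - 1" by simp
      let ?B = "(1 * ?Q ^ (d * nu 0)) powr (1 / (v - (w - 1)))"
      have "?S v \<subseteq> {P. Polynomial.degree P \<le> n \<and> height P \<le> ?B}"
      proof
        fix P assume "P \<in> ?S v"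
        hence P: "Polynomial.degree P \<le> n" "0 < abs_fls (eval_fls P (xi :: 'a fls))"
          "abs_fls (eval_fls P (xi :: 'a fls)) \<le> height P powr (- v)" by auto
        have "P \<noteq> 0" using P(2) by auto
        hence "height P \<le> ?B" using P assms v by (intro height_bounded_of_small_value) auto
        thus "P \<in> {P. Polynomial.degree P \<le> n \<and> height P \<le> ?B}" using P(1) by simp
      qed
      thus False using inf finite_subset finite_bounded_height by blast
    qed
  qed
  have "infinite (?S (w - 1))"
  proof (rule infinite_super)
    show "infinite (lin ` {j. real (nu (Suc j)) = w * real (nu j)} :: 'a poly poly set)"
      using ratio_eq inj_lin by (subst finite_image_iff) (auto intro: inj_on_subset)
    show "lin ` {j. real (nu (Suc j)) = w * real (nu j)} \<subseteq> ?S (w - 1)"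
    proof (clarify, intro conjI)
      fix j assume j: "real (nu (Suc j)) = w * real (nu j)"
      show "Polynomial.degree (lin j :: 'a poly poly) \<le> n"
        using assms by (simp only: degree_lin)
      show "0 < abs_fls (eval_fls (lin j) (xi :: 'a fls))"
        unfolding abs_lin_xi using Q by simp
      have "abs_fls (eval_fls (lin j) (xi :: 'a fls)) = (?Q ^ nu j) powr 1 * (?Q ^ nu j) powr (- w)"
        unfolding abs_lin_xi den_powr[OF j, symmetric] using Q by simp
      also have "\<dots> = (?Q ^ nu j) powr (- (w - 1))" by (subst powr_add[symmetric]) simp
      finally show "abs_fls (eval_fls (lin j) (xi :: 'a fls)) \<le> height (lin j :: 'a poly poly) powr (- (w - 1))"
        unfolding height_lin by simp
    qed
  qed
  thus "ereal (w - 1) \<le> Sup {ereal v | v. infinite (?S v)}" by (intro Sup_upper) blast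
qed

text \<open>Primitivity is the point: a common divisor of the two coefficients divides a power of T
  and has nonzero constant term, hence is a unit. In degree 1 irreducibility follows.\<close>

lemma is_min_poly_lin: "is_min_poly (lin j) (to_ac (conv j :: 'a::{finite,field} fls))"
proof (intro conjI)
  show "0 < Polynomial.degree (lin j :: 'a poly poly)" by (simp only: degree_lin)
  have unit: "is_unit c" if dvd: "c dvd num j" "c dvd den j" for c :: "'a poly"
  proof -
    have "Polynomial.coeff c 0 \<noteq> 0"
    proof
      assume "Polynomial.coeff c 0 = 0"
      moreover obtain e where "num j = c * e" using dvd(1) by blast
      ultimately show False using coeff_num_0[of j, where 'a = 'a] by (simp add: coeff_mult_0)
    qed
    thus ?thesis using dvd(2) dvd_mult_monom_cancel[of c 1 "nu j"] by (simp add: den_def)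
  qed
  show prim: "primitive_poly (lin j :: 'a poly poly)"
    unfolding primitive_poly_def
  proof (intro allI impI)
    fix c :: "'a poly" assume c: "\<forall>i. c dvd Polynomial.coeff (lin j) i"
    show "c dvd 1"
      by (rule unit) (use c[rule_format, of 0] c[rule_format, of 1] in \<open>auto simp: lin_def\<close>)
  qed
  have const_unit: "is_unit A"
    if fac: "lin j = A * B" "Polynomial.degree A = 0" for A B :: "'a poly poly"
  proof -
    obtain c where c: "A = [:c:]" using fac(2) by (metis degree_eq_zeroE)
    have "[:c:] dvd lin j" using fac(1) unfolding c by (rule dvdI)
    hence "c dvd 1" using prim by (auto simp: const_poly_dvd_iff primitive_poly_def)
    thus ?thesis using c by (simp add: is_unit_const_poly_iff)
  qed
  show "Factorial_Ring.irreducible (lin j :: 'a poly poly)"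
  proof (rule Factorial_Ring.irreducibleI)
    show "(lin j :: 'a poly poly) \<noteq> 0" by (rule lin_nz)
    show "\<not> is_unit (lin j :: 'a poly poly)"
      using den_nz[of j, where 'a = 'a] by (auto simp: is_unit_poly_iff lin_def)
    fix A B :: "'a poly poly" assume AB: "lin j = A * B"
    have "A \<noteq> 0" "B \<noteq> 0" using AB lin_nz[of j, where 'a = 'a] by auto
    hence "Polynomial.degree A + Polynomial.degree B = 1"
      using AB degree_lin[of j, where 'a = 'a] by (simp add: degree_mult_eq)
    hence "Polynomial.degree A = 0 \<or> Polynomial.degree B = 0" by auto
    thus "is_unit A \<or> is_unit B"
      using const_unit[of A B] const_unit[of B A] AB by (auto simp: mult.commute)
  qed
  show "lead_coeff (lead_coeff (lin j :: 'a poly poly)) = 1"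
    using den_nz[of j, where 'a = 'a] by (simp add: lin_def) (simp add: den_def degree_monom_eq)
  have "eval_fls (lin j) (conv j :: 'a fls) = 0"
    by (simp add: lin_def eval_fls_pCons fls_of_T_poly_minus conv_def den_nz)
  thus "eval_ac (lin j) (to_ac (conv j :: 'a fls)) = 0" by (simp add: eval_ac_to_ac)
qed

text \<open>By the Lipschitz bound, \<open>|P(xi)|\<close> for the minimal polynomial
  \<open>P\<close> of \<open>\<alpha>\<close> is at most a constant times height times distance. The
  extra 1 in the exponent absorbs the height, which reduces the upper bound to small values of
  polynomials; the convergents give the lower bound.\<close>

lemma w_star_exp_xi:
  assumes "1 \<le> n" "n \<le> d"
  shows "w_star_exp n (xi :: 'a::{finite,field} fls) = ereal (w - 1)"
  unfolding w_star_exp_def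
proof (rule antisym)
  let ?Q = "real CARD('a)"
  have Q: "?Q > 1" using card_field_ge2[where 'a = 'a] by simp
  let ?x = "to_ac (xi :: 'a fls)"
  let ?S = "\<lambda>v. {\<alpha> \<in> algebraic_over_FqT. alg_degree \<alpha> \<le> n \<and>
     0 < abs_ac (?x - \<alpha>) \<and> abs_ac (?x - \<alpha>) \<le> alg_height \<alpha> powr (- v - 1)}"
  show "Sup {ereal v | v. infinite (?S v)} \<le> ereal (w - 1)"
  proof (rule Sup_least, clarify)
    fix v assume inf: "infinite (?S v)"
    show "ereal v \<le> ereal (w - 1)"
    proof (rule ccontr)
      assume "\<not> ?thesis"
      hence v: "v > w - 1" by simp
      let ?B = "(3 ^ Suc n * ?Q ^ (d * nu 0)) powr (1 / (v - (w - 1)))"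
      let ?F = "{P :: 'a poly poly. Polynomial.degree P \<le> n \<and> height P \<le> ?B}"
      have "?S v \<subseteq> {\<alpha> \<in> algebraic_over_FqT. min_poly \<alpha> \<in> ?F}"
      proof
        fix \<alpha> assume "\<alpha> \<in> ?S v"
        hence \<alpha>: "\<alpha> \<in> algebraic_over_FqT" "alg_degree \<alpha> \<le> n" "abs_ac (?x - \<alpha>) \<le> alg_height \<alpha> powr (- v - 1)"
          by auto
        define P where "P = min_poly \<alpha>"
        have P: "Polynomial.degree P > 0" "eval_ac P \<alpha> = 0"
          using min_poly[OF \<alpha>(1)] by (auto simp: P_def)
        have P0: "P \<noteq> 0" using P by auto
        have dP: "Polynomial.degree P \<le> n" using \<alpha>(2) by (simp add: alg_degree_def P_def)
        have dist: "abs_ac (?x - \<alpha>) \<le> height P powr (- v - 1)"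
          using \<alpha>(3) by (simp add: alg_height_def P_def)
        have H: "height P \<ge> 1" by (rule height_ge_1[OF P0])
        \<comment> \<open>The exponent is negative and the height at least 1, so the distance is at
          most 1 and \<open>\<alpha>\<close> stays in the ball of radius 2 required by the Lipschitz
          bound.\<close>
        have "height P powr (- v - 1) \<le> height P powr 0"
          using v w_gt H by (intro powr_mono) auto
        hence "abs_ac (?x - \<alpha>) \<le> 1" using dist H by simp
        moreover have "abs_ac (?x + - (?x - \<alpha>)) \<le> abs_ac ?x + abs_ac (- (?x - \<alpha>))"
          by (rule absolute_value_triangle[OF abs_ac(1)])
        moreover have "abs_ac (- (?x - \<alpha>)) = abs_ac (?x - \<alpha>)"
          by (rule absolute_value_minus[OF abs_ac(1)])
        moreover have x: "abs_ac ?x \<le> 1" by (simp add: abs_ac(2) abs_xi_le)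
        ultimately have y: "abs_ac \<alpha> \<le> 2" by simp
        have "abs_fls (eval_fls P (xi :: 'a fls)) = abs_ac (eval_ac P ?x - eval_ac P \<alpha>)"
          by (simp add: P(2) eval_ac_to_ac abs_ac(2))
        also have "\<dots> \<le> height P * 3 ^ Suc n * abs_ac (?x - \<alpha>)"
          by (rule eval_ac_Lipschitz[OF x y dP])
        also have "\<dots> \<le> height P * 3 ^ Suc n * height P powr (- v - 1)"
          using dist H by (intro mult_left_mono) auto
        also have "\<dots> = 3 ^ Suc n * (height P powr 1 * height P powr (- v - 1))"
          using H by simp
        also have "\<dots> = 3 ^ Suc n * height P powr (- v)" by (subst powr_add[symmetric]) simp
        finally have "height P \<le> ?B"
          using P0 dP assms v by (intro height_bounded_of_small_value) auto
        thus "\<alpha> \<in> {\<alpha> \<in> algebraic_over_FqT. min_poly \<alpha> \<in> ?F}"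
          using \<alpha>(1) dP by (simp add: P_def)
      qed
      thus False using inf finite_subset finite_min_poly_preimage[OF finite_bounded_height] by blast
    qed
  qed
  have "infinite (?S (w - 1))"
  proof (rule infinite_super)
    let ?f = "\<lambda>j. to_ac (conv j :: 'a fls)"
    have min: "min_poly (?f j) = lin j" "?f j \<in> algebraic_over_FqT" for j
      using min_poly_eqI[OF is_min_poly_lin] by auto
    have "inj ?f"
    proof (rule injI)
      fix i j assume "?f i = ?f j"
      hence "(lin i :: 'a poly poly) = lin j" using min(1)[of i] min(1)[of j] by simp
      thus "i = j" using injD[OF inj_lin] by blast
    qed
    thus "infinite (?f ` {j. real (nu (Suc j)) = w * real (nu j)})"
      using ratio_eq by (subst finite_image_iff) (auto intro: inj_on_subset)
    show "?f ` {j. real (nu (Suc j)) = w * real (nu j)} \<subseteq> ?S (w - 1)"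
    proof (clarify, intro conjI)
      fix j assume j: "real (nu (Suc j)) = w * real (nu j)"
      show "?f j \<in> algebraic_over_FqT" by (rule min)
      show "alg_degree (?f j) \<le> n"
        unfolding alg_degree_def min using assms by (simp only: degree_lin)
      have "abs_ac (?x - ?f j) = abs_fls (xi - conv j :: 'a fls)"
        by (simp add: abs_ac(2) flip: to_ac_diff)
      also have "\<dots> = (?Q ^ nu j) powr (- w)" by (simp only: abs_xi_minus_conv den_powr[OF j])
      finally have *: "abs_ac (?x - ?f j) = (?Q ^ nu j) powr (- w)" .
      show "0 < abs_ac (?x - ?f j)" unfolding * using Q by simp
      show "abs_ac (?x - ?f j) \<le> alg_height (?f j) powr (- (w - 1) - 1)"
        unfolding * alg_height_def min height_lin by simp
    qed
  qed
  thus "ereal (w - 1) \<le> Sup {ereal v | v. infinite (?S v)}" by (intro Sup_upper) blast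
qed

end

section \<open>Automaticity and the choice of the exponents\<close>

text \<open>A Myhill-Nerode argument: the values of \<open>g\<close> are the states, and appending
  the digit \<open>r\<close>, which turns \<open>n\<close> into \<open>k * n + r\<close>, is well
  defined on them. They are encoded as natural numbers by \<open>e\<close>.\<close>

lemma k_automatic_via_congruence:
  fixes g :: "nat \<Rightarrow> 's" and a :: "nat \<Rightarrow> 'b"
  assumes "k \<ge> 2" "finite (range g)"
    and cong: "\<And>m n r. r < k \<Longrightarrow> g m = g n \<Longrightarrow> g (k * m + r) = g (k * n + r)"
    and out: "\<And>m n. g m = g n \<Longrightarrow> a m = a n"
  shows "k_automatic k a"
proof -
  obtain e :: "'s \<Rightarrow> nat" where e: "inj_on e (range g)"
    using finite_imp_inj_to_nat_seg[OF assms(2)] by metis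
  define rep where "rep s = (SOME n. e (g n) = s)" for s
  have rep: "g (rep (e (g n))) = g n" for n
  proof -
    have "e (g (rep (e (g n)))) = e (g n)" unfolding rep_def by (rule someI[of _ n]) simp
    thus ?thesis using e by (auto dest: inj_onD)
  qed
  define M :: "(nat, 'b) automaton" where
    "M = \<lparr>states = e ` range g, step = (\<lambda>s r. e (g (k * rep s + r))), start = e (g 0),
      alphabet = a ` rep ` e ` range g, out_map = (\<lambda>s. a (rep s))\<rparr>"
  have step: "step M (e (g n)) r = e (g (k * n + r))" if "r < k" for n r
    using cong[OF that rep[of n]] by (simp add: M_def)
  have run: "foldl (step M) (start M) (base_word k n) = e (g n)" for n
  proof (induction n rule: less_induct)
    case (less n)
    show ?case
    proof (cases "n < k")
      case True
      hence "base_word k n = [n]" by (subst base_word.simps) simp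
      \<comment> \<open>The start state belongs to 0, so a one-digit word leads to the class of
        \<open>k * 0 + n\<close>.\<close>
      thus ?thesis using step[OF True, of 0] by (simp add: M_def)
    next
      case False
      hence bw: "base_word k n = base_word k (n div k) @ [n mod k]"
        using assms(1) by (subst base_word.simps) simp
      have "n div k < n" using False assms(1) by (intro div_less_dividend) auto
      from less.IH[OF this] show ?thesis
        using step[of "n mod k" "n div k"] assms(1) by (simp add: bw)
    qed
  qed
  have "is_k_automaton k M"
    unfolding is_k_automaton_def using assms(2) by (auto simp: M_def)
  moreover have "a n = out_map M (foldl (step M) (start M) (base_word k n))" for n
    unfolding run using out[OF rep[of n]] by (simp add: M_def)
  ultimately show ?thesis unfolding k_automatic_def by blast
qed

lemma k_automatic_indicator_geometric:
  fixes C :: "nat set"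
  assumes "k \<ge> 2" "b > 0" "finite C" "0 \<notin> C"
  shows "k_automatic k (\<lambda>n. if n \<in> {c * k ^ (b * j) | c j. c \<in> C} then 1 else 0 :: 'b::zero_neq_one)"
proof -
  \<comment> \<open>The state reached on \<open>n\<close> records \<open>n\<close> capped at a bound for \<open>C\<close>, and for which \<open>c \<in> C\<close>
    and which number of trailing zeros modulo \<open>b\<close> the number \<open>n\<close> is \<open>c\<close> followed by zeros.\<close>
  define A where "A n = {(c, t). c \<in> C \<and> t < b \<and> (\<exists>j. n = c * k ^ (b * j + t))}"
    for n
  define M where "M = Suc (Max (insert 0 C))"
  have M: "c < M" if "c \<in> C" for c using that assms(3) by (simp add: M_def less_Suc_eq_le)
  define g where "g n = (min n M, A n)" for n
  \<comment> \<open>After a nonzero digit only members of \<open>C\<close> themselves remain; a zero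
    digit also raises \<open>t\<close> by one modulo \<open>b\<close>. Adding \<open>n < M\<close>
    is harmless since \<open>C\<close> lies below \<open>M\<close>, and the capped value can decide
    it.\<close>
  have A_step: "A (k * n + r) = {(c, t). c \<in> C \<and> t < b \<and>
      ((t = 0 \<and> n < M \<and> k * n + r = c) \<or>
       (r = 0 \<and> (if t = 0 then (c, b - 1) \<in> A n else (c, t - 1) \<in> A n)))}" if r: "r < k" for n r
  proof -
    have "(\<exists>j. k * n + r = c * k ^ (b * j + t)) \<longleftrightarrow>
       ((t = 0 \<and> n < M \<and> k * n + r = c) \<or>
       (r = 0 \<and> (if t = 0 then (c, b - 1) \<in> A n else (c, t - 1) \<in> A n)))" (is "?L \<longleftrightarrow> ?R")
      if c: "c \<in> C" and t: "t < b" for c t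
    proof
      assume ?L
      then obtain j where j: "k * n + r = c * k ^ (b * j + t)" by blast
      show ?R
      proof (cases "b * j + t")
        case 0
        hence "k * n + r = c" "t = 0" using j by auto
        moreover have "n \<le> k * n" using assms(1) by simp
        hence "n < M" using M[OF c] calculation by linarith
        ultimately show ?thesis by simp
      next
        case (Suc e)
        hence "k * n + r = k * (c * k ^ e)" using j by simp
        moreover have "r = (k * n + r) mod k" using r by simp
        ultimately have "r = 0" by (metis mod_mult_self1_is_0)
        with \<open>k * n + r = k * (c * k ^ e)\<close> have n: "n = c * k ^ e" using assms(1) by simp
        show ?thesis
        proof (cases "t = 0")
          case True
          then obtain j' where "j = Suc j'" using Suc by (cases j) auto
          hence "e = b * j' + (b - 1)" using Suc True assms(2) by (simp add: algebra_simps)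
          thus ?thesis using \<open>r = 0\<close> n True c assms(2) by (auto simp: A_def)
        next
          case False
          hence "e = b * j + (t - 1)" using Suc by simp
          thus ?thesis using \<open>r = 0\<close> n False c t by (auto simp: A_def)
        qed
      qed
    next
      assume ?R
      thus ?L
      proof
        assume "t = 0 \<and> n < M \<and> k * n + r = c"
        thus ?L by (intro exI[of _ 0]) simp
      next
        assume *: "r = 0 \<and> (if t = 0 then (c, b - 1) \<in> A n else (c, t - 1) \<in> A n)"
        show ?L
        proof (cases "t = 0")
          case True
          hence "(c, b - 1) \<in> A n" using * by simp
          then obtain j where n: "n = c * k ^ (b * j + (b - 1))" unfolding A_def by blast
          have e: "b * Suc j + t = Suc (b * j + (b - 1))" using True assms(2) by simp
          have "k * n + r = c * k ^ (b * Suc j + t)"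
            unfolding e n using * by (simp add: mult.left_commute)
          thus ?thesis by blast
        next
          case False
          hence "(c, t - 1) \<in> A n" using * by simp
          then obtain j where n: "n = c * k ^ (b * j + (t - 1))" unfolding A_def by blast
          have e: "b * j + t = Suc (b * j + (t - 1))" using False by simp
          have "k * n + r = c * k ^ (b * j + t)"
            unfolding e n using * by (simp add: mult.left_commute)
          thus ?thesis by blast
        qed
      qed
    qed
    note eq = this
    show ?thesis
    proof (rule Set.set_eqI)
      fix x :: "nat \<times> nat"
      obtain c t where x: "x = (c, t)" by force
      show "x \<in> A (k * n + r) \<longleftrightarrow> x \<in> {(c, t). c \<in> C \<and> t < b \<and>
          ((t = 0 \<and> n < M \<and> k * n + r = c) \<or>
           (r = 0 \<and> (if t = 0 then (c, b - 1) \<in> A n else (c, t - 1) \<in> A n)))}"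
        unfolding x A_def[of "k * n + r"] mem_Collect_eq prod.case using eq[of c t] by blast
    qed
  qed
  show ?thesis
  proof (rule k_automatic_via_congruence[where g = g])
    show "k \<ge> 2" by fact
    show "finite (range g)"
    proof (rule finite_subset)
      show "range g \<subseteq> {..M} \<times> Pow (C \<times> {..<b})" by (auto simp: g_def A_def)
      show "finite ({..M} \<times> Pow (C \<times> {..<b}))" using assms(3) by simp
    qed
  next
    fix m n r assume r: "r < k" and eq: "g m = g n"
    hence A: "A m = A n" and mn: "min m M = min n M" by (auto simp: g_def)
    \<comment> \<open>In the second case the clause of \<open>A_step\<close> that compares with
      \<open>c\<close> directly fails for both numbers.\<close>
    have "n = m \<or> (m \<ge> M \<and> n \<ge> M)"
      using mn by (auto simp: min_def split: if_splits)
    thus "g (k * m + r) = g (k * n + r)"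
    proof
      assume big: "m \<ge> M \<and> n \<ge> M"
      have "m \<le> k * m" "n \<le> k * n" using assms(1) by auto
      hence "min (k * m + r) M = min (k * n + r) M" using big by linarith
      moreover have "A (k * m + r) = A (k * n + r)" unfolding A_step[OF r] A using big by auto
      ultimately show ?thesis by (simp add: g_def)
    qed simp
  next
    fix m n assume "g m = g n"
    hence A: "A m = A n" by (simp add: g_def)
    have "n \<in> {c * k ^ (b * j) | c j. c \<in> C} \<longleftrightarrow> (\<exists>c. (c, 0) \<in> A n)"
      for n
      using assms(2) by (auto simp: A_def)
    thus "(if m \<in> {c * k ^ (b * j) | c j. c \<in> C} then 1 else 0 :: 'b) =
        (if n \<in> {c * k ^ (b * j) | c j. c \<in> C} then 1 else 0)" using A by simp
  qed
qed

text \<open>In logarithms to base \<open>w\<close> the equation says that \<open>\<rho>\<close> has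
  logarithm \<open>x / m\<close> with \<open>x = b * \<beta> - 1\<close>, and this must lie between
  \<open>\<theta>\<close> and 1. Take for \<open>m\<close> the least integer above \<open>x\<close>,
  with \<open>x\<close> large.\<close>

lemma exists_near_root:
  fixes w w0 K :: real
  assumes "1 < w0" "w0 < w" "1 < K"
  shows "\<exists>b m \<rho>. b > 0 \<and> m > 0 \<and> w0 < \<rho> \<and> \<rho> < w \<and> w * \<rho> ^ m = K ^ b"
proof -
  define \<beta> where "\<beta> = ln K / ln w"
  define \<theta> where "\<theta> = ln w0 / ln w"
  have lw: "ln w > 0" using assms by simp
  have \<beta>: "\<beta> > 0" using assms lw by (simp add: \<beta>_def)
  have \<theta>: "\<theta> < 1" "\<theta> > 0" using assms lw by (auto simp: \<theta>_def)
  \<comment> \<open>Large enough that \<open>m > 1 / (1 - \<theta>)\<close>, whence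
    \<open>m * \<theta> < m - 1 \<le> x\<close>.\<close>
  obtain b :: nat where b: "(1 / (1 - \<theta>) + 3) / \<beta> < real b"
    using reals_Archimedean2 by blast
  hence b': "1 / (1 - \<theta>) + 3 < real b * \<beta>" using \<beta> by (simp add: field_simps)
  define x where "x = real b * \<beta> - 1"
  have x: "x > 1 / (1 - \<theta>) + 2" using b' by (simp add: x_def)
  have pos: "1 / (1 - \<theta>) > 0" using \<theta> by simp
  define m where "m = nat \<lfloor>x\<rfloor> + 1"
  have m: "real m > x" "real m - 1 \<le> x" "m > 0" using x pos unfolding m_def by linarith+
  have "1 / (1 - \<theta>) < real m" using m x by linarith
  hence "1 < real m * (1 - \<theta>)" using \<theta> by (simp add: field_simps)
  hence mt: "real m * \<theta> < x" using m by (simp add: algebra_simps)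
  define \<rho> where "\<rho> = exp (x * ln w / real m)"
  have "ln w0 < x * ln w / real m"
  proof -
    have "real m * \<theta> * ln w < x * ln w" using mt lw by simp
    moreover have "\<theta> * ln w = ln w0" using lw by (simp add: \<theta>_def)
    ultimately have "real m * ln w0 < x * ln w" by (metis mult.assoc)
    thus ?thesis using m by (simp add: field_simps)
  qed
  hence 1: "w0 < \<rho>" using assms exp_less_mono[of "ln w0"] by (simp add: \<rho>_def)
  have "x * ln w / real m < ln w" using m lw by (simp add: field_simps)
  hence 2: "\<rho> < w"
    using assms exp_less_mono[of "x * ln w / real m" "ln w"] by (simp add: \<rho>_def)
  have "\<rho> ^ m = exp (x * ln w)" using m by (simp add: \<rho>_def exp_of_nat_mult[symmetric])
  also have "x * ln w = real b * ln K - ln w"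
    using lw by (simp add: x_def \<beta>_def algebra_simps)
  finally have "w * \<rho> ^ m = K ^ b"
    using assms by (simp add: exp_diff exp_of_nat_mult)
  moreover have "b > 0" using b \<beta> pos by (cases b) (auto simp: field_simps divide_less_0_iff)
  ultimately show ?thesis using 1 2 m by blast
qed

text \<open>Multiply the real sequence \<open>1, w, w * \<rho>, ..., w * \<rho> ^ m = k ^ b\<close>
  by a large \<open>N\<close> and round up. The first ratio \<open>w\<close> and the end point stay
  exact; the other ratios start from \<open>\<rho>\<close>, strictly inside the allowed interval,
  and survive rounding.\<close>

lemma exists_cycle:
  fixes w w0 :: real and k p l :: nat
  assumes "1 < w0" "w0 < w" "k \<ge> 2" "w = real p / real l" "l > 0"
  shows "\<exists>b m (C :: nat \<Rightarrow> nat). b > 0 \<and> m > 0 \<and> C 0 > 0 \<and> C m = C 0 * k ^ b \<and>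
    real (C 1) = w * real (C 0) \<and>
    (\<forall>i<m. w0 * real (C i) \<le> real (C (Suc i)) \<and> real (C (Suc i)) \<le> w * real (C i))"
proof -
  obtain b m \<rho> where bm: "b > 0" "m > 0" "w0 < \<rho>" "\<rho> < w" "w * \<rho> ^ m = real k ^ b"
    using exists_near_root[of w0 w "real k"] assms by auto
  define c where "c i = (case i of 0 \<Rightarrow> 1 | Suc i \<Rightarrow> w * \<rho> ^ i)" for i
  have c1: "c i \<ge> 1" for i
  proof (cases i)
    case (Suc j)
    have "1 * 1 \<le> w * \<rho> ^ j" using assms(1,2) bm(3) by (intro mult_mono one_le_power) auto
    thus ?thesis by (simp add: c_def Suc)
  qed (simp add: c_def)
  \<comment> \<open>The margins \<open>(w - \<rho>) * N > 1\<close> and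
    \<open>(\<rho> - w0) * N > w0\<close> absorb a rounding error below 1. Making \<open>N\<close> a
    multiple of \<open>l\<close> turns \<open>w * N\<close> into an integer.\<close>
  obtain N0 :: nat where N0: "1 / (w - \<rho>) + w0 / (\<rho> - w0) < real N0"
    using reals_Archimedean2 by blast
  define N where "N = l * Suc N0"
  have "Suc N0 \<le> N" using assms(5) mult_le_mono1[of 1 l "Suc N0"] by (simp add: N_def)
  hence "real N0 < real N" by linarith
  have p1: "1 / (w - \<rho>) > 0" "w0 / (\<rho> - w0) > 0" using bm assms by auto
  have "1 / (w - \<rho>) < real N" "w0 / (\<rho> - w0) < real N" using N0 \<open>real N0 < real N\<close> p1 by linarith+
  hence N: "1 < (w - \<rho>) * real N" "w0 < (\<rho> - w0) * real N"
    using bm by (simp_all add: field_simps)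
  define C where "C i = nat \<lceil>c i * real N\<rceil>" for i
  have C: "c i * real N \<le> real (C i)" "real (C i) < c i * real N + 1" for i
  proof -
    have "c i * real N \<ge> 0" using c1[of i] by simp
    thus "c i * real N \<le> real (C i)" "real (C i) < c i * real N + 1"
      unfolding C_def by linarith+
  qed
  have C_int: "C i = n" if "c i * real N = real n" for i n using that by (simp add: C_def)
  have C0: "C 0 = N" by (rule C_int) (simp add: c_def)
  have C1: "C 1 = p * Suc N0" by (rule C_int) (use assms in \<open>simp add: c_def N_def field_simps\<close>)
  have Cm: "C (Suc m) = N * k ^ b"
    by (rule C_int) (use bm in \<open>simp add: c_def\<close>)
  have C1': "real (C 1) = w * real (C 0)"
    unfolding C1 C0 using assms by (simp add: N_def field_simps)
  have "w0 * real (C i) \<le> real (C (Suc i)) \<and> real (C (Suc i)) \<le> w * real (C i)" for i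
  proof (cases i)
    case 0
    thus ?thesis using C1' assms(2) by (simp add: mult_right_mono)
  next
    case (Suc j)
    have step: "c (Suc i) = \<rho> * c i" using Suc by (simp add: c_def)
    have "w0 * real (C i) \<le> w0 * (c i * real N + 1)"
      using C[of i] assms by (intro mult_left_mono) auto
    also have "\<dots> \<le> w0 * (c i * real N) + c i * ((\<rho> - w0) * real N)"
    proof -
      have "w0 \<le> 1 * ((\<rho> - w0) * real N)" using N by simp
      also have "\<dots> \<le> c i * ((\<rho> - w0) * real N)"
        using c1[of i] N assms by (intro mult_right_mono) auto
      finally show ?thesis by (simp add: algebra_simps)
    qed
    also have "\<dots> = c (Suc i) * real N" unfolding step by (simp add: algebra_simps)
    also have "\<dots> \<le> real (C (Suc i))" by (rule C)
    finally have 1: "w0 * real (C i) \<le> real (C (Suc i))" .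
    have "real (C (Suc i)) \<le> \<rho> * (c i * real N) + 1"
      using C(2)[of "Suc i"] unfolding step by (simp add: algebra_simps)
    also have "1 \<le> c i * ((w - \<rho>) * real N)"
    proof -
      have "1 \<le> 1 * ((w - \<rho>) * real N)" using N by simp
      also have "\<dots> \<le> c i * ((w - \<rho>) * real N)"
        using c1[of i] N by (intro mult_right_mono) auto
      finally show ?thesis .
    qed
    also have "\<rho> * (c i * real N) + c i * ((w - \<rho>) * real N) = w * (c i * real N)"
      by (simp add: algebra_simps)
    also have "\<dots> \<le> w * real (C i)" using C[of i] assms by (intro mult_left_mono) auto
    finally show ?thesis using 1 by simp
  qed
  moreover have "C 0 > 0" using assms by (simp add: C0 N_def)
  \<comment> \<open>One step of ratio \<open>w\<close> and \<open>m\<close> steps of ratio near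
    \<open>\<rho>\<close> make a cycle of length \<open>Suc m\<close>.\<close>
  ultimately show ?thesis using bm(1) C1' Cm C0
    by (intro exI[of _ b] exI[of _ "Suc m"] exI[of _ C]) auto
qed

section \<open>Assembling the sequence\<close>

theorem theorem5p3:
  fixes d k :: nat and w :: real
  assumes "d \<ge> 1" and "k \<ge> 2"
    and "w > (2 * real d + 1 + sqrt (4 * (real d)\<^sup>2 + 1)) / 2"
    and "w \<in> S_set k"
  shows "\<exists>a :: nat \<Rightarrow> 'a::{finite,field}. k_automatic k a \<and>
    (let \<xi> = fps_to_fls (Abs_fps a) in
      \<forall>n\<in>{1..d}. w_exp n \<xi> = ereal (w - 1) \<and> w_star_exp n \<xi> = ereal (w - 1))"
proof -
  obtain a l where al: "w = real k ^ a / real l" "l \<ge> 1"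
    using assms(4) by (auto simp: S_set_def)
  define D where "D = real d"
  have D: "D \<ge> 1" using assms(1) by (simp add: D_def)
  have s: "sqrt (4 * D\<^sup>2 + 1) < 2 * w - 2 * D - 1"
    using assms(3) by (simp add: D_def field_simps)
  \<comment> \<open>This crude bound already makes the denominator \<open>w - 1 - D\<close>
    positive.\<close>
  moreover have "sqrt (4 * D\<^sup>2 + 1) \<ge> 2 * D" by (rule real_le_rsqrt) simp
  ultimately have w2: "w > 2 * D + 1 / 2" by linarith
  have "4 * D\<^sup>2 + 1 < (2 * w - 2 * D - 1)\<^sup>2"
    using power_strict_mono[OF s, of 2] by simp
  \<comment> \<open>The squared hypothesis on \<open>w\<close>, which after clearing the denominator
    is exactly \<open>w0 < w\<close>.\<close>
  hence quad: "w * w - w - 2 * D * w + D > 0" by (simp add: power2_eq_square algebra_simps)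
  \<comment> \<open>The value for which the condition \<open>gap\<close> holds with
    equality.\<close>
  define w0 where "w0 = D * (w - 1) / (w - 1 - D)"
  have pos: "w - 1 - D > 0" using w2 D by simp
  have w0w: "w0 < w" using quad pos by (simp add: w0_def divide_less_eq algebra_simps)
  have w0D: "w0 > D" using pos D by (simp add: w0_def less_divide_eq)
  obtain b m C where bmC: "b > 0" "m > 0" "C 0 > 0" "C m = C 0 * k ^ b"
    "real (C 1) = w * real (C 0)"
    "\<And>i. i < m \<Longrightarrow> w0 * real (C i) \<le> real (C (Suc i)) \<and> real (C (Suc i)) \<le> w * real (C i)"
    using exists_cycle[of w0 w k "k ^ a" l] w0w w0D D al assms(2) by auto
  \<comment> \<open>After every \<open>m\<close> steps the cycle is repeated with an extra factor
    \<open>k ^ b\<close>; since \<open>C m = C 0 * k ^ b\<close>, the passage between blocks is a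
    step of the cycle too.\<close>
  define nu where "nu s = C (s mod m) * k ^ (b * (s div m))" for s
  have Suc_nu: "nu (Suc s) = C (Suc (s mod m)) * k ^ (b * (s div m))" for s
  proof (cases "Suc (s mod m) = m")
    case True
    hence "Suc s mod m = 0" "Suc s div m = Suc (s div m)" by (auto simp: mod_Suc div_Suc)
    thus ?thesis using True bmC(4) by (simp add: nu_def power_add)
  next
    case False
    hence "Suc s mod m = Suc (s mod m)" "Suc s div m = s div m" by (auto simp: mod_Suc div_Suc)
    thus ?thesis by (simp add: nu_def)
  qed
  have ratio: "w0 * real (nu s) \<le> real (nu (Suc s))" "real (nu (Suc s)) \<le> w * real (nu s)"
    for s
  proof -
    have "s mod m < m" using bmC(2) by simp
    from bmC(6)[OF this] show "w0 * real (nu s) \<le> real (nu (Suc s))" "real (nu (Suc s)) \<le> w * real (nu s)"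
      unfolding Suc_nu
        unfolding nu_def by (auto simp: mult.assoc[symmetric] intro!: mult_right_mono)
  qed
  have C_pos: "C i > 0" if "i < m" for i
    using that
  proof (induction i)
    case (Suc i)
    have "0 < w0 * real (C i)" using Suc w0D D by simp
    thus ?case using bmC(6)[of i] Suc.prems by (metis Suc_lessD less_le_trans of_nat_0_less_iff)
  qed (use bmC in auto)
  have nu_pos: "nu s > 0" for s using C_pos[of "s mod m"] bmC(2) assms(2) by (simp add: nu_def)
  interpret lacunary nu w w0 d
  proof
    show "strict_mono nu"
    proof (rule strict_mono_Suc_iff[THEN iffD2], rule allI)
      fix s
      have "real (nu s) < w0 * real (nu s)" using nu_pos[of s] w0D D by simp
      thus "nu s < nu (Suc s)" using ratio(1)[of s] by linarith
    qed
    show "nu 0 > 0" by (rule nu_pos)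
    \<comment> \<open>Every block begins with the step from \<open>C 0\<close> to
      \<open>C 1\<close>, whose ratio is exactly \<open>w\<close>.\<close>
    have "range (\<lambda>j. m * j) \<subseteq> {j. real (nu (Suc j)) = w * real (nu j)}"
      using bmC(5) bmC(2) unfolding Suc_nu by (auto simp: nu_def)
    moreover have "infinite (range (\<lambda>j. m * j))"
      using bmC(2) by (intro range_inj_infinite) (auto simp: inj_def)
    ultimately show "infinite {j. real (nu (Suc j)) = w * real (nu j)}" by (rule infinite_super)
    show "w > 1" using w2 D by simp
    show "w0 > real d" using w0D by (simp add: D_def)
    have "1 - D / w0 = D / (w - 1)" using D pos w0D by (simp add: w0_def field_simps)
    thus "real d \<le> (w - 1) * (1 - real d / w0)" using pos D by (simp add: D_def)
  qed (use ratio in auto)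
  \<comment> \<open>The support is a finite union of geometric progressions of ratio
    \<open>k ^ b\<close>, which is automatic.\<close>
  have "range nu = {c * k ^ (b * j) | c j. c \<in> C ` {..<m}}"
  proof (intro equalityI subsetI)
    fix x assume "x \<in> range nu"
    thus "x \<in> {c * k ^ (b * j) | c j. c \<in> C ` {..<m}}" using bmC(2) by (auto simp: nu_def)
  next
    fix x assume "x \<in> {c * k ^ (b * j) | c j. c \<in> C ` {..<m}}"
    then obtain i j where "i < m" "x = C i * k ^ (b * j)" by auto
    hence "x = nu (m * j + i)" by (simp add: nu_def)
    thus "x \<in> range nu" by blast
  qed
  moreover have "0 \<notin> C ` {..<m}" using C_pos by force
  ultimately have "k_automatic k (\<lambda>n. if n \<in> range nu then 1 else 0 :: 'a)"
    using k_automatic_indicator_geometric[OF assms(2) bmC(1), of "C ` {..<m}"] by simp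
  moreover have "\<forall>n\<in>{1..d}. w_exp n (xi :: 'a fls) = ereal (w - 1) \<and> w_star_exp n (xi :: 'a fls) = ereal (w - 1)"
    using w_exp_xi w_star_exp_xi by auto
  ultimately show ?thesis unfolding xi_def Let_def by blast
qed

end
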